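(* Let $\{X_t\}_{t\ge1}$ be a stationary Gaussian sequence with $\mathbb E X_t=0$, $\mathbb E X_t^2=1$ and covariance $\rho(h)=\mathbb E[X_tX_{t+h}]\sim c\,h^{-\alpha}L_0(h)$ as $h\to\infty$, where $c>0$, $0<\alpha<1$, and $L_0$ is slowly varying at infinity. Let $G\in L^2(\mathbb R,\phi)$ have Hermite rank $m\ge1$ with Hermite coefficients $J_q$, and let $a_n=n^{-d}\ell_a(n)$, $n\ge1$, where $d\in\mathbb R$ and $\ell_a$ is slowly varying at infinity. Assume $\alpha m<1$ and $2d+\alpha m<1$. Let $S_n=\sum_{t=1}^n a_tG(X_t)$, $A_n^2=\operatorname{Var}(S_n)$, and $$R_n:=S_n-\frac{J_m}{m!}\sum_{t=1}^n a_tH_m(X_t).$$ Then $$\limsup_{n\to\infty}\frac{|R_n|}{A_n(2\log\log n)^{m/2}}=0\qquad\text{a.s.}$$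
   Context: $\phi$ is the standard Gaussian measure on $\mathbb R$; $H_q(x)=(-1)^qe^{x^2/2}\frac{d^q}{dx^q}e^{-x^2/2}$ is the $q$-th Hermite polynomial. $G\in L^2(\mathbb R,\phi)$ has Hermite rank $m\ge1$ if $G=\sum_{q=m}^\infty\frac{J_q}{q!}H_q$ in $L^2(\mathbb R,\phi)$ with $J_q=\int_{\mathbb R}G H_q\,d\phi$ and $J_m\ne0$. Slowly varying functions $L$ are measurable, eventually positive, with $L(rx)/L(x)\to1$ as $x\to\infty$ for every $r>0$. $A_n\ge0$ is the square root of $\operatorname{Var}(S_n)$ (it is positive for all large $n$). *)

theory Defs
  imports "HOL-Probability.Probability" "HOL-Library.Landau_Symbols"
begin

definition std_gaussian :: "real measure" where
  "std_gaussian = density lborel (\<lambda>x. ennreal (std_normal_density x))"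

definition hermite :: "nat \<Rightarrow> real \<Rightarrow> real" where
  "hermite q x = (-1) ^ q * exp (x\<^sup>2 / 2) * (deriv ^^ q) (\<lambda>y. exp (- y\<^sup>2 / 2)) x"

definition L2_gaussian :: "(real \<Rightarrow> real) \<Rightarrow> bool" where
  "L2_gaussian G \<longleftrightarrow>
     G \<in> borel_measurable borel \<and> integrable std_gaussian (\<lambda>x. (G x)\<^sup>2)"

definition hermite_coeff :: "(real \<Rightarrow> real) \<Rightarrow> nat \<Rightarrow> real" where
  "hermite_coeff G q = (\<integral>x. G x * hermite q x \<partial>std_gaussian)"

text \<open>The last conjunct is convergence in mean square of the Hermite series started at \<open>m\<close>;
  it forces the coefficients of order below \<open>m\<close> to vanish.\<close>

definition has_hermite_rank :: "(real \<Rightarrow> real) \<Rightarrow> nat \<Rightarrow> bool" where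
  "has_hermite_rank G m \<longleftrightarrow>
     L2_gaussian G \<and> 1 \<le> m \<and> hermite_coeff G m \<noteq> 0 \<and>
     (\<lambda>N. \<integral>x. (G x - (\<Sum>q=m..N. hermite_coeff G q / fact q * hermite q x))\<^sup>2 \<partial>std_gaussian)
       \<longlonglongrightarrow> 0"

definition slowly_varying :: "(real \<Rightarrow> real) \<Rightarrow> bool" where
  "slowly_varying L \<longleftrightarrow>
     L \<in> borel_measurable borel \<and> (\<forall>\<^sub>F x in at_top. 0 < L x) \<and>
     (\<forall>r>0. ((\<lambda>x. L (r * x) / L x) \<longlongrightarrow> 1) at_top)"

text \<open>Constants count as degenerate Gaussian variables: the library's \<open>normal_density\<close>
  is a probability density only for positive standard deviation.\<close>

definition gaussian_rv :: "'a measure \<Rightarrow> ('a \<Rightarrow> real) \<Rightarrow> bool" where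
  "gaussian_rv M Y \<longleftrightarrow>
     (\<exists>\<mu> \<sigma>. 0 < \<sigma> \<and> distributed M lborel Y (\<lambda>x. ennreal (normal_density \<mu> \<sigma> x))) \<or>
     (Y \<in> borel_measurable M \<and> (\<exists>\<mu>. AE \<omega> in M. Y \<omega> = \<mu>))"

text \<open>Sequences are indexed from 1; the value of \<open>X\<close> at 0 is irrelevant. Joint Gaussianity is
  Gaussianity of all finite linear combinations.\<close>

definition gaussian_sequence :: "'a measure \<Rightarrow> (nat \<Rightarrow> 'a \<Rightarrow> real) \<Rightarrow> bool" where
  "gaussian_sequence M X \<longleftrightarrow>
     (\<forall>T u. finite T \<and> T \<subseteq> {1..} \<longrightarrow> gaussian_rv M (\<lambda>\<omega>. \<Sum>t\<in>T. u t * X t \<omega>))"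

definition stationary_sequence :: "'a measure \<Rightarrow> (nat \<Rightarrow> 'a \<Rightarrow> real) \<Rightarrow> bool" where
  "stationary_sequence M X \<longleftrightarrow>
     (\<forall>t\<ge>1. X t \<in> borel_measurable M) \<and>
     (\<forall>T h. finite T \<and> T \<subseteq> {1..} \<longrightarrow>
        distr M (\<Pi>\<^sub>M t\<in>T. borel) (\<lambda>\<omega>. \<lambda>t\<in>T. X (t + h) \<omega>) =
        distr M (\<Pi>\<^sub>M t\<in>T. borel) (\<lambda>\<omega>. \<lambda>t\<in>T. X t \<omega>))"

end

theory Submission
  imports Defs "HOL-Computational_Algebra.Polynomial"
begin

text \<open>The remainder \<open>R\<^sub>n\<close> is the weighted sum of \<open>g = G - J\<^sub>m/m! H\<^sub>m\<close>, whose Hermite expansion starts at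
  order \<open>m + 1\<close>. Hence \<open>\<bar>E g(X\<^sub>s) g(X\<^sub>t)\<bar>\<close> is at most a constant times \<open>\<bar>\<rho>(s - t)\<bar>\<close> to the power \<open>m + 1\<close>,
  whereas \<open>A\<^sub>n\<^sup>2\<close> is at least the variance of the orthogonal part carried by \<open>H\<^sub>m\<close>, which is governed by
  \<open>\<rho>\<close> to the power \<open>m\<close>. Slowly varying factors only cost powers \<open>n\<^sup>e\<close> with arbitrarily small \<open>e\<close>, so
  \<open>E R\<^sub>n\<^sup>2\<close> is smaller than \<open>A\<^sub>n\<^sup>2\<close> by a power of \<open>n\<close>. A dyadic chaining (Rademacher--Menshov) argument
  loses only logarithms in passing to \<open>max R\<^sub>n\<^sup>2\<close> over \<open>n \<le> 2\<^sup>K\<close>, and summing over \<open>K\<close> gives even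
  \<open>R\<^sub>n / A\<^sub>n \<longlonglongrightarrow> 0\<close> almost surely.\<close>

subsection \<open>Square-integrable functions\<close>

text \<open>Up to arbitrarily small exponents, the squared weights sum to at most n^(1 - 2d), the
  row sums of |\<rho>|^(m + 1) are at most n^max(1 - \<alpha>(m + 1), 0), and A_n^2 is at least of
  order n^(2 - 2d - \<alpha> m). The exponent gap is therefore min(\<alpha>, 1 - \<alpha> m), which
  is positive because \<alpha> > 0 and \<alpha> m < 1. The condition 2d + \<alpha> m < 1 lifts the
  exponent of A_n^2 above 1, so that the index pairs on which only crude bounds hold cannot cancel
  the main part of the variance. A_n enters only through its lower bound by a power of n, and such a
  power changes by a bounded factor between consecutive powers of two, as chaining requires. A pair
  with equal indices has no joint density, so covariances of Hermite polynomials are derived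
  algebraically, from the moments of the linear combinations by which joint normality is
  defined.\<close>

lemma integrable_mult_of_squares:
  fixes f g :: "'a \<Rightarrow> real"
  assumes [measurable]: "f \<in> borel_measurable M" "g \<in> borel_measurable M"
    and "integrable M (\<lambda>\<omega>. (f \<omega>)\<^sup>2)" "integrable M (\<lambda>\<omega>. (g \<omega>)\<^sup>2)"
  shows "integrable M (\<lambda>\<omega>. f \<omega> * g \<omega>)"
proof (rule Bochner_Integration.integrable_bound)
  show "integrable M (\<lambda>\<omega>. (f \<omega>)\<^sup>2 + (g \<omega>)\<^sup>2)" using assms by simp
  have "\<bar>x * y\<bar> \<le> x\<^sup>2 + y\<^sup>2" for x y :: real
    using sum_squares_bound[of "\<bar>x\<bar>" "\<bar>y\<bar>"] zero_le_power2[of x] zero_le_power2[of y]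
    unfolding abs_mult power2_abs by linarith
  then show "AE \<omega> in M. norm (f \<omega> * g \<omega>) \<le> norm ((f \<omega>)\<^sup>2 + (g \<omega>)\<^sup>2)" by simp
qed measurable

lemma integrable_square_add:
  fixes f g :: "'a \<Rightarrow> real"
  assumes "f \<in> borel_measurable M" "g \<in> borel_measurable M"
    and "integrable M (\<lambda>\<omega>. (f \<omega>)\<^sup>2)" "integrable M (\<lambda>\<omega>. (g \<omega>)\<^sup>2)"
  shows "integrable M (\<lambda>\<omega>. (f \<omega> + g \<omega>)\<^sup>2)"
proof -
  have "integrable M (\<lambda>\<omega>. (f \<omega>)\<^sup>2 + (g \<omega>)\<^sup>2 + 2 * (f \<omega> * g \<omega>))"
    using integrable_mult_of_squares[OF assms] assms by simp
  then show ?thesis by (simp add: power2_sum mult.assoc)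
qed

lemma integrable_square_diff:
  fixes f g :: "'a \<Rightarrow> real"
  assumes "f \<in> borel_measurable M" "g \<in> borel_measurable M"
    and "integrable M (\<lambda>\<omega>. (f \<omega>)\<^sup>2)" "integrable M (\<lambda>\<omega>. (g \<omega>)\<^sup>2)"
  shows "integrable M (\<lambda>\<omega>. (f \<omega> - g \<omega>)\<^sup>2)"
  using integrable_square_add[of f M "\<lambda>\<omega>. - g \<omega>"] assms by simp

lemma integrable_square_sum:
  fixes f :: "'i \<Rightarrow> 'a \<Rightarrow> real"
  assumes "\<And>i. i \<in> I \<Longrightarrow> f i \<in> borel_measurable M" "\<And>i. i \<in> I \<Longrightarrow> integrable M (\<lambda>\<omega>. (f i \<omega>)\<^sup>2)"
  shows "integrable M (\<lambda>\<omega>. (\<Sum>i\<in>I. f i \<omega>)\<^sup>2)"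
  using assms by (induction I rule: infinite_finite_induct) (simp_all add: integrable_square_add)

lemma integral_Cauchy_Schwarz:
  fixes f g :: "'a \<Rightarrow> real"
  assumes [measurable]: "f \<in> borel_measurable M" "g \<in> borel_measurable M"
    and f: "integrable M (\<lambda>\<omega>. (f \<omega>)\<^sup>2)" and g: "integrable M (\<lambda>\<omega>. (g \<omega>)\<^sup>2)"
  shows "\<bar>\<integral>\<omega>. f \<omega> * g \<omega> \<partial>M\<bar> \<le> sqrt (\<integral>\<omega>. (f \<omega>)\<^sup>2 \<partial>M) * sqrt (\<integral>\<omega>. (g \<omega>)\<^sup>2 \<partial>M)"
proof -
  define a b c where "a = (\<integral>\<omega>. (f \<omega>)\<^sup>2 \<partial>M)" "b = (\<integral>\<omega>. f \<omega> * g \<omega> \<partial>M)" "c = (\<integral>\<omega>. (g \<omega>)\<^sup>2 \<partial>M)"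
  \<comment> \<open>A quadratic in \<open>t\<close> that is an integral of a square; nonnegativity
    for all \<open>t\<close> bounds its discriminant.\<close>
  have pos: "0 \<le> a + 2 * t * b + t\<^sup>2 * c" for t
  proof -
    have "0 \<le> (\<integral>\<omega>. (f \<omega> + t * g \<omega>)\<^sup>2 \<partial>M)" by simp
    also have "\<dots> = (\<integral>\<omega>. (f \<omega>)\<^sup>2 + 2 * t * (f \<omega> * g \<omega>) + t\<^sup>2 * (g \<omega>)\<^sup>2 \<partial>M)"
      by (intro Bochner_Integration.integral_cong) (simp_all add: power2_sum power_mult_distrib ac_simps)
    also have "\<dots> = a + 2 * t * b + t\<^sup>2 * c"
      using f g integrable_mult_of_squares[of f M g] by (simp add: a_b_c_def)
    finally show ?thesis .
  qed
  have "a \<ge> 0" "c \<ge> 0" by (simp_all add: a_b_c_def)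
  have "b\<^sup>2 \<le> a * c"
  proof (cases "c = 0")
    case True
    have "b = 0"
    proof (rule ccontr)
      assume "b \<noteq> 0"
      \<comment> \<open>With \<open>c = 0\<close> the expression is affine in \<open>t\<close>, and
        at this point its value is -1.\<close>
      then show False using pos[of "- (a + 1) / (2 * b)"] True by (simp add: field_simps)
    qed
    then show ?thesis using \<open>a \<ge> 0\<close> \<open>c \<ge> 0\<close> by simp
  next
    case False
    \<comment> \<open>The point \<open>- b / c\<close> is the minimiser of the quadratic.\<close>
    have "0 \<le> a - b\<^sup>2 / c" using pos[of "- b / c"] False by (simp add: power2_eq_square field_simps)
    then show ?thesis using False \<open>c \<ge> 0\<close> by (simp add: field_simps)
  qed
  then have "\<bar>b\<bar> \<le> sqrt (a * c)" using real_le_rsqrt[of "\<bar>b\<bar>"] by simp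
  then show ?thesis by (simp add: a_b_c_def real_sqrt_mult)
qed

text \<open>Writing the approximants as limit minus error, the product differs from
  \<open>f * g\<close> by three terms, each with an error factor, and Cauchy-Schwarz makes them
  vanish. This carries covariances of finite Hermite sums over to their mean-square limits.\<close>

lemma L2_inner_tendsto:
  fixes f g :: "'a \<Rightarrow> real"
  assumes [measurable]: "f \<in> borel_measurable M" "g \<in> borel_measurable M"
      "\<And>n. fn n \<in> borel_measurable M" "\<And>n. gn n \<in> borel_measurable M"
    and int: "integrable M (\<lambda>\<omega>. (f \<omega>)\<^sup>2)" "integrable M (\<lambda>\<omega>. (g \<omega>)\<^sup>2)"
      "\<And>n. integrable M (\<lambda>\<omega>. (fn n \<omega>)\<^sup>2)" "\<And>n. integrable M (\<lambda>\<omega>. (gn n \<omega>)\<^sup>2)"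
    and f: "(\<lambda>n. \<integral>\<omega>. (f \<omega> - fn n \<omega>)\<^sup>2 \<partial>M) \<longlonglongrightarrow> 0"
    and g: "(\<lambda>n. \<integral>\<omega>. (g \<omega> - gn n \<omega>)\<^sup>2 \<partial>M) \<longlonglongrightarrow> 0"
  shows "(\<lambda>n. \<integral>\<omega>. fn n \<omega> * gn n \<omega> \<partial>M) \<longlonglongrightarrow> (\<integral>\<omega>. f \<omega> * g \<omega> \<partial>M)"
proof -
  let ?N = "\<lambda>h. sqrt (\<integral>\<omega>. (h \<omega>)\<^sup>2 \<partial>M)"
  let ?df = "\<lambda>n \<omega>. f \<omega> - fn n \<omega>" and ?dg = "\<lambda>n \<omega>. g \<omega> - gn n \<omega>"
  have meas: "f \<in> borel_measurable M" "g \<in> borel_measurable M"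
    "\<And>n. fn n \<in> borel_measurable M" "\<And>n. gn n \<in> borel_measurable M"
    "\<And>n. ?df n \<in> borel_measurable M" "\<And>n. ?dg n \<in> borel_measurable M" by simp_all
  have sq: "integrable M (\<lambda>\<omega>. (?df n \<omega>)\<^sup>2)" "integrable M (\<lambda>\<omega>. (?dg n \<omega>)\<^sup>2)" for n
    by (intro integrable_square_diff meas int)+
  have bound: "\<bar>(\<integral>\<omega>. fn n \<omega> * gn n \<omega> \<partial>M) - (\<integral>\<omega>. f \<omega> * g \<omega> \<partial>M)\<bar>
      \<le> ?N (?df n) * ?N (?dg n) + ?N f * ?N (?dg n) + ?N (?df n) * ?N g" for n
  proof -
    have i: "integrable M (\<lambda>\<omega>. fn n \<omega> * gn n \<omega>)" "integrable M (\<lambda>\<omega>. f \<omega> * g \<omega>)"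
      "integrable M (\<lambda>\<omega>. ?df n \<omega> * ?dg n \<omega>)" "integrable M (\<lambda>\<omega>. f \<omega> * ?dg n \<omega>)"
      "integrable M (\<lambda>\<omega>. ?df n \<omega> * g \<omega>)"
      by (rule integrable_mult_of_squares; rule meas sq int)+
    have "(\<integral>\<omega>. fn n \<omega> * gn n \<omega> \<partial>M) =
       (\<integral>\<omega>. f \<omega> * g \<omega> + ?df n \<omega> * ?dg n \<omega> - f \<omega> * ?dg n \<omega> - ?df n \<omega> * g \<omega> \<partial>M)"
      by (intro Bochner_Integration.integral_cong) (simp_all add: algebra_simps)
    also have "\<dots> = (\<integral>\<omega>. f \<omega> * g \<omega> \<partial>M) + (\<integral>\<omega>. ?df n \<omega> * ?dg n \<omega> \<partial>M)
       - (\<integral>\<omega>. f \<omega> * ?dg n \<omega> \<partial>M) - (\<integral>\<omega>. ?df n \<omega> * g \<omega> \<partial>M)"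
      using i by (simp only: Bochner_Integration.integral_add Bochner_Integration.integral_diff
          Bochner_Integration.integrable_add Bochner_Integration.integrable_diff)
    finally have eq: "(\<integral>\<omega>. fn n \<omega> * gn n \<omega> \<partial>M) = \<dots>" .
    have "\<bar>\<integral>\<omega>. ?df n \<omega> * ?dg n \<omega> \<partial>M\<bar> \<le> ?N (?df n) * ?N (?dg n)"
      "\<bar>\<integral>\<omega>. f \<omega> * ?dg n \<omega> \<partial>M\<bar> \<le> ?N f * ?N (?dg n)"
      "\<bar>\<integral>\<omega>. ?df n \<omega> * g \<omega> \<partial>M\<bar> \<le> ?N (?df n) * ?N g"
      by (rule integral_Cauchy_Schwarz; rule meas sq int)+
    with eq show ?thesis by linarith
  qed
  have "(\<lambda>n. ?N (?df n)) \<longlonglongrightarrow> sqrt 0" "(\<lambda>n. ?N (?dg n)) \<longlonglongrightarrow> sqrt 0"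
    using f g by (intro tendsto_real_sqrt; simp)+
  then have "(\<lambda>n. ?N (?df n) * ?N (?dg n) + ?N f * ?N (?dg n) + ?N (?df n) * ?N g) \<longlonglongrightarrow>
      sqrt 0 * sqrt 0 + ?N f * sqrt 0 + sqrt 0 * ?N g"
    by (intro tendsto_add tendsto_mult tendsto_const)
  then have "(\<lambda>n. ?N (?df n) * ?N (?dg n) + ?N f * ?N (?dg n) + ?N (?df n) * ?N g) \<longlonglongrightarrow> 0" by simp
  then have "(\<lambda>n. (\<integral>\<omega>. fn n \<omega> * gn n \<omega> \<partial>M) - (\<integral>\<omega>. f \<omega> * g \<omega> \<partial>M)) \<longlonglongrightarrow> 0"
    by (rule Lim_null_comparison[rotated]) (simp add: bound)
  then show ?thesis by (simp add: LIM_zero_iff)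
qed

lemma integral_sum_mult_sum:
  fixes f :: "'i \<Rightarrow> 'a \<Rightarrow> real" and g :: "'j \<Rightarrow> 'a \<Rightarrow> real"
  assumes "\<And>i j. i \<in> I \<Longrightarrow> j \<in> J \<Longrightarrow> integrable M (\<lambda>\<omega>. f i \<omega> * g j \<omega>)"
  shows "(\<integral>\<omega>. (\<Sum>i\<in>I. f i \<omega>) * (\<Sum>j\<in>J. g j \<omega>) \<partial>M) = (\<Sum>i\<in>I. \<Sum>j\<in>J. \<integral>\<omega>. f i \<omega> * g j \<omega> \<partial>M)"
  using assms by (simp add: sum_product)

subsection \<open>Hermite polynomials of correlated Gaussian variables\<close>

text \<open>Formal polynomials make differentiation algebraic and let Stein's identity be extended
  from monomials by linearity; \<open>hermite_eq_poly\<close> ties them to the Rodrigues formula in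
  \<open>hermite_def\<close>.\<close>

primrec hermite_poly :: "nat \<Rightarrow> real poly" where
  "hermite_poly 0 = 1"
| "hermite_poly (Suc q) = pCons 0 (hermite_poly q) - pderiv (hermite_poly q)"

lemma higher_deriv_gauss:
  "(deriv ^^ q) (\<lambda>y. exp (- y\<^sup>2 / 2)) = (\<lambda>x. (-1) ^ q * poly (hermite_poly q) x * exp (- x\<^sup>2 / 2))"
proof (induction q)
  case (Suc q)
  have "deriv (\<lambda>x. (-1) ^ q * poly (hermite_poly q) x * exp (- x\<^sup>2 / 2)) x =
      (-1) ^ Suc q * poly (hermite_poly (Suc q)) x * exp (- x\<^sup>2 / 2)" for x :: real
    by (rule DERIV_imp_deriv) (auto intro!: derivative_eq_intros simp: algebra_simps)
  then show ?case by (intro ext) (simp only: funpow.simps o_apply Suc.IH)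
qed simp

lemma hermite_eq_poly: "hermite q x = poly (hermite_poly q) x"
proof -
  have "exp (x\<^sup>2 / 2) * exp (- x\<^sup>2 / 2) = (1::real)" "((-1) ^ q * (-1) ^ q :: real) = 1"
    by (simp_all flip: exp_add power_add)
  then have "((-1) ^ q * (-1) ^ q) * (exp (x\<^sup>2 / 2) * exp (- x\<^sup>2 / 2)) * poly (hermite_poly q) x
      = poly (hermite_poly q) x" by simp
  then show ?thesis unfolding hermite_def higher_deriv_gauss by (simp add: ac_simps)
qed

text \<open>The Appell property. Together with Stein's identity it lowers both Hermite indices of a
  covariance at once.\<close>

lemma pderiv_hermite_poly: "pderiv (hermite_poly (Suc q)) = smult (real (Suc q)) (hermite_poly q)"
proof (induction q)
  case 0
  show ?case by (simp add: pderiv_pCons)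
next
  case (Suc q)
  have "pderiv (hermite_poly (Suc (Suc q))) =
      hermite_poly (Suc q) + pCons 0 (pderiv (hermite_poly (Suc q))) - pderiv (pderiv (hermite_poly (Suc q)))"
    by (simp add: pderiv_pCons pderiv_diff)
  also have "\<dots> = hermite_poly (Suc q) +
      smult (real (Suc q)) (pCons 0 (hermite_poly q) - pderiv (hermite_poly q))"
    unfolding Suc by (simp add: pderiv_smult smult_diff_right)
  also have "\<dots> = smult (real (Suc (Suc q))) (hermite_poly (Suc q))"
    by (simp add: smult_add_left[of 1 "real (Suc q)", simplified] flip: hermite_poly.simps(2))
  finally show ?case .
qed

section \<open>Moments of one Gaussian variable and of a Gaussian pair\<close>

lemma gaussian_rv_measurable: "gaussian_rv M Z \<Longrightarrow> Z \<in> borel_measurable M"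
  unfolding gaussian_rv_def by (auto dest: distributed_measurable)

text \<open>The factor \<open>fact (2 * k) / (2 ^ k * fact k)\<close> is the double factorial (2k -
  1)!!. Expressed through the second moment, the formula also covers the degenerate variable, which
  is almost surely 0: there only the moment of order 0 survives, with
  \<open>0 ^ 0 = 1\<close>.\<close>

lemma centred_gaussian_moments:
  assumes "prob_space M" and Z: "gaussian_rv M Z" and mean: "(\<integral>\<omega>. Z \<omega> \<partial>M) = 0"
  shows integrable_gaussian_power: "integrable M (\<lambda>\<omega>. Z \<omega> ^ k)"
    and gaussian_even_moment:
      "(\<integral>\<omega>. Z \<omega> ^ (2 * k) \<partial>M) = fact (2 * k) / (2 ^ k * fact k) * (\<integral>\<omega>. (Z \<omega>)\<^sup>2 \<partial>M) ^ k"
    and gaussian_odd_moment: "(\<integral>\<omega>. Z \<omega> ^ (2 * k + 1) \<partial>M) = 0"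
proof -
  interpret prob_space M by fact
  have meas: "Z \<in> borel_measurable M" using Z by (rule gaussian_rv_measurable)
  have "integrable M (\<lambda>\<omega>. Z \<omega> ^ k) \<and>
    (\<integral>\<omega>. Z \<omega> ^ (2 * k) \<partial>M) = fact (2 * k) / (2 ^ k * fact k) * (\<integral>\<omega>. (Z \<omega>)\<^sup>2 \<partial>M) ^ k \<and>
    (\<integral>\<omega>. Z \<omega> ^ (2 * k + 1) \<partial>M) = 0"
    using Z unfolding gaussian_rv_def
  proof (elim disjE exE conjE)
    fix \<mu> \<sigma> :: real
    assume \<sigma>: "0 < \<sigma>" and D: "distributed M lborel Z (\<lambda>x. ennreal (normal_density \<mu> \<sigma> x))"
    have "\<mu> = 0" using mean distributed_integral[OF D, of "\<lambda>x. x"] integral_normal_moment_nz_1[OF \<sigma>, of \<mu>]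
      by simp
    note D = D[unfolded this]
    have E: "(\<integral>\<omega>. Z \<omega> ^ j \<partial>M) = (\<integral>x. normal_density 0 \<sigma> x * x ^ j \<partial>lborel)" for j
      using distributed_integral[OF D, of "\<lambda>x. x ^ j"] by simp
    have ev: "(\<integral>\<omega>. Z \<omega> ^ (2 * j) \<partial>M) = fact (2 * j) / ((2 / \<sigma>\<^sup>2)^j * fact j)" for j
      using integral_normal_moment_even[OF \<sigma>, of 0 j] unfolding E by simp
    have var: "(\<integral>\<omega>. (Z \<omega>)\<^sup>2 \<partial>M) = \<sigma>\<^sup>2" using ev[of 1] by simp
    have "integrable M (\<lambda>\<omega>. Z \<omega> ^ k)"
      using distributed_integrable[OF D, of "\<lambda>x. x ^ k"] integrable_normal_moment[OF \<sigma>, of 0 k] by simp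
    moreover have "(\<integral>\<omega>. Z \<omega> ^ (2 * k + 1) \<partial>M) = 0"
      using integral_normal_moment_odd[OF \<sigma>, of 0 k] unfolding E by simp
    ultimately show ?thesis unfolding ev var by (simp add: power_divide)
  next
    fix \<mu> assume "AE \<omega> in M. Z \<omega> = \<mu>"
    moreover from this have "expectation Z = expectation (\<lambda>_. \<mu>)"
      using meas by (intro integral_cong_AE) auto
    ultimately have AE: "AE \<omega> in M. Z \<omega> = 0" using mean by (simp add: prob_space)
    have E: "expectation (\<lambda>\<omega>. Z \<omega> ^ j) = expectation (\<lambda>_. 0 ^ j)" for j
      using AE meas by (intro integral_cong_AE) auto
    have "integrable M (\<lambda>\<omega>. Z \<omega> ^ k) \<longleftrightarrow> integrable M (\<lambda>_. 0 ^ k :: real)"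
      using AE meas by (intro integrable_cong_AE) auto
    then show ?thesis unfolding E by (cases k) (auto simp: prob_space)
  qed
  then show "integrable M (\<lambda>\<omega>. Z \<omega> ^ k)"
    "(\<integral>\<omega>. Z \<omega> ^ (2 * k) \<partial>M) = fact (2 * k) / (2 ^ k * fact k) * (\<integral>\<omega>. (Z \<omega>)\<^sup>2 \<partial>M) ^ k"
    "(\<integral>\<omega>. Z \<omega> ^ (2 * k + 1) \<partial>M) = 0" by auto
qed

text \<open>The value of \<open>r\<close> may be 1 or -1: a variable paired with itself is an
  instance, and no joint density is presupposed.\<close>

locale gaussian_pair = prob_space M for M :: "'a measure" +
  fixes X Y :: "'a \<Rightarrow> real" and r :: real
  assumes gaussian: "\<And>u v. gaussian_rv M (\<lambda>\<omega>. u * X \<omega> + v * Y \<omega>)"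
    and mean_X: "expectation X = 0" and mean_Y: "expectation Y = 0"
    and var_X: "expectation (\<lambda>\<omega>. (X \<omega>)\<^sup>2) = 1" and var_Y: "expectation (\<lambda>\<omega>. (Y \<omega>)\<^sup>2) = 1"
    and cov: "expectation (\<lambda>\<omega>. X \<omega> * Y \<omega>) = r"
begin

lemma swap: "gaussian_pair M Y X r"
proof
  show "gaussian_rv M (\<lambda>\<omega>. u * Y \<omega> + v * X \<omega>)" for u v
    using gaussian[of v u] by (simp only: add.commute)
qed (use mean_X mean_Y var_X var_Y cov in \<open>simp_all add: mult.commute\<close>)

lemma gaussian_XY: "gaussian_rv M X" "gaussian_rv M Y"
  using gaussian[of 1 0] gaussian[of 0 1] by simp_all

lemma measurable_XY [measurable]: "X \<in> borel_measurable M" "Y \<in> borel_measurable M"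
  using gaussian_XY by (simp_all add: gaussian_rv_measurable)

lemma integrable_power_XY: "integrable M (\<lambda>\<omega>. X \<omega> ^ k)" "integrable M (\<lambda>\<omega>. Y \<omega> ^ k)"
  using integrable_gaussian_power prob_space_axioms gaussian_XY mean_X mean_Y by blast+

lemma integrable_monomial: "integrable M (\<lambda>\<omega>. X \<omega> ^ i * Y \<omega> ^ j)"
  by (rule integrable_mult_of_squares) (simp_all add: integrable_power_XY flip: power_mult)

definition moment :: "nat \<Rightarrow> nat \<Rightarrow> real" where
  "moment i j = expectation (\<lambda>\<omega>. X \<omega> ^ i * Y \<omega> ^ j)"

text \<open>The coefficients of this polynomial in the coefficient of \<open>X\<close> are, up to binomials, the joint
  moments of degree \<open>n\<close>, so the univariate moments of \<open>uX + Y\<close> determine all of them.\<close>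

definition moment_poly :: "nat \<Rightarrow> real poly" where
  "moment_poly n = (\<Sum>k\<le>n. monom (real (n choose k) * moment k (n - k)) k)"

lemma coeff_moment_poly:
  "coeff (moment_poly n) k = (if k \<le> n then real (n choose k) * moment k (n - k) else 0)"
  by (simp add: moment_poly_def coeff_sum)

lemma poly_moment_poly: "poly (moment_poly n) u = expectation (\<lambda>\<omega>. (u * X \<omega> + 1 * Y \<omega>) ^ n)"
proof -
  have "expectation (\<lambda>\<omega>. (u * X \<omega> + 1 * Y \<omega>) ^ n) =
     expectation (\<lambda>\<omega>. \<Sum>k\<le>n. real (n choose k) * u ^ k * (X \<omega> ^ k * Y \<omega> ^ (n - k)))"
    by (simp only: binomial_ring power_mult_distrib mult.assoc mult_1_left)
  also have "\<dots> = (\<Sum>k\<le>n. real (n choose k) * u ^ k * moment k (n - k))"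
    by (subst Bochner_Integration.integral_sum) (auto simp: moment_def integrable_monomial)
  finally show ?thesis by (simp add: moment_poly_def poly_sum poly_monom ac_simps)
qed

lemma mean_comb: "expectation (\<lambda>\<omega>. u * X \<omega> + v * Y \<omega>) = 0"
  using integrable_power_XY[of 1] by (simp add: mean_X mean_Y)

lemma var_comb: "expectation (\<lambda>\<omega>. (u * X \<omega> + 1 * Y \<omega>)\<^sup>2) = poly [:1, 2 * r, 1:] u"
proof -
  have "expectation (\<lambda>\<omega>. (u * X \<omega> + 1 * Y \<omega>)\<^sup>2) =
     expectation (\<lambda>\<omega>. u\<^sup>2 * (X \<omega>)\<^sup>2 + (2 * u * (X \<omega> * Y \<omega>) + (Y \<omega>)\<^sup>2))"
    by (simp add: power2_sum power_mult_distrib ac_simps)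
  also have "\<dots> = u\<^sup>2 + (2 * u * r + 1)"
    using integrable_power_XY[of 2] integrable_monomial[of 1 1] by (simp add: var_X var_Y cov)
  finally show ?thesis by (simp add: algebra_simps power2_eq_square)
qed

lemma moment_poly_odd: "moment_poly (2 * k + 1) = 0"
proof -
  have "poly (moment_poly (2 * k + 1)) = poly 0"
    using gaussian_odd_moment[OF prob_space_axioms gaussian mean_comb] by (simp only: fun_eq_iff poly_moment_poly poly_0 simp_thms)
  then show ?thesis by (simp only: poly_eq_poly_eq_iff)
qed

lemma moment_poly_even: "moment_poly (2 * k) = smult (fact (2 * k) / (2 ^ k * fact k)) ([:1, 2 * r, 1:] ^ k)"
proof -
  have "poly (moment_poly (2 * k)) = poly (smult (fact (2 * k) / (2 ^ k * fact k)) ([:1, 2 * r, 1:] ^ k))"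
    by (simp only: fun_eq_iff poly_moment_poly poly_smult poly_power
      gaussian_even_moment[OF prob_space_axioms gaussian mean_comb] var_comb) simp
  then show ?thesis by (simp only: poly_eq_poly_eq_iff)
qed

text \<open>Stein's identity in generating form: d/du of E(uX + Y)^(n+2) is (n+2) E X(uX + Y)^(n+1).
  For even order it is the chain rule for the power of the variance u^2 + 2ru + 1, whose derivative
  is 2(u + r), and the ratio of consecutive double factorials supplies the remaining factor. For odd
  order both sides vanish.\<close>

lemma pderiv_moment_poly:
  "pderiv (moment_poly (Suc (Suc n))) = smult (real (Suc (Suc n)) * real (Suc n)) ([:r, 1:] * moment_poly n)"
proof (cases "even n")
  case True
  then obtain k where n: "n = 2 * k" by blast
  have Ssn: "Suc (Suc n) = 2 * Suc k" by (simp add: n)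
  have c: "fact (2 * Suc k) / (2 ^ Suc k * fact (Suc k)) * (real (Suc k) * 2)
     = real (Suc (Suc n)) * real (Suc n) * (fact n / (2 ^ k * fact k) :: real)"
  proof -
    have "fact (2 * Suc k) = real (Suc (Suc n)) * real (Suc n) * fact (2 * k)"
      unfolding Ssn[symmetric] fact_Suc n by (simp only: mult.assoc)
    moreover have "x / (2 ^ Suc k * (y * f)) * (y * 2) = x / (2 ^ k * f)" if "y \<noteq> 0" for x y f :: real
      using that by (simp add: field_simps)
    ultimately show ?thesis by (simp only: fact_Suc n) simp
  qed
  have "pderiv [:1, 2 * r, 1:] = smult 2 [:r, 1:]"
    by (simp add: pderiv_pCons numeral_poly)
  then have "pderiv (moment_poly (2 * Suc k)) =
     smult (fact (2 * Suc k) / (2 ^ Suc k * fact (Suc k)) * (real (Suc k) * 2)) ([:r, 1:] * [:1, 2 * r, 1:] ^ k)"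
    by (simp only: moment_poly_even pderiv_smult pderiv_power_Suc mult_smult_left mult_smult_right smult_smult)
       (simp add: ac_simps)
  then show ?thesis unfolding c unfolding Ssn[symmetric]
    by (simp only: moment_poly_even[of k, folded n] mult_smult_right smult_smult)
next
  case False
  then obtain k where n: "n = 2 * k + 1" by (blast elim: oddE)
  have Ssn: "Suc (Suc n) = 2 * Suc k + 1" by (simp add: n)
  show ?thesis unfolding Ssn moment_poly_odd unfolding n moment_poly_odd by simp
qed

text \<open>Stein's identity on monomials, read off as the coefficient of u^p in
  \<open>pderiv_moment_poly\<close>. Where \<open>p - 1\<close> or \<open>q - 1\<close> is
  truncated, the factor in front is 0.\<close>

lemma moment_Suc:
  "moment (Suc p) q = real p * moment (p - 1) q + r * real q * moment p (q - 1)"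
proof (cases "p + q = 0")
  case True
  then show ?thesis by (simp add: moment_def mean_X)
next
  case False
  then obtain n where n: "p + q = Suc n" by (cases "p + q") auto
  have b: "coeff (pderiv (moment_poly (Suc (Suc n)))) p = real (Suc p) * real (Suc (Suc n) choose Suc p) * moment (Suc p) q"
  proof -
    have "Suc (Suc n) - Suc p = q" "Suc p \<le> Suc (Suc n)" using n by auto
    then show ?thesis by (simp only: coeff_pderiv coeff_moment_poly if_True mult.assoc)
  qed
  have "real (Suc p) * real (Suc (Suc n) choose Suc p) = real (Suc (Suc n)) * real (Suc n choose p)"
    using Suc_times_binomial[of p "Suc n"] by (metis of_nat_mult)
  moreover have "coeff (smult (x * y) ([:r, 1:] * g)) p =
      x * (y * (r * coeff g p + (if p = 0 then 0 else coeff g (p - 1))))" for x y g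
    by (simp add: coeff_pCons split: nat.split)
  ultimately have eq: "real (Suc (Suc n)) * (real (Suc n choose p) * moment (Suc p) q) =
    real (Suc (Suc n)) * (real (Suc n) * (r * coeff (moment_poly n) p + (if p = 0 then 0 else coeff (moment_poly n) (p - 1))))"
    using b pderiv_moment_poly[of n] by (simp only: mult.assoc[symmetric])
  \<comment> \<open>The absorption identities for binomials bring out the common factor
    \<open>Suc n choose p\<close> in both terms, so that it can be cancelled at the end.\<close>
  have 1: "real (Suc n) * coeff (moment_poly n) p = real (Suc n choose p) * (real q * moment p (q - 1))"
  proof (cases q)
    case (Suc q')
    then have "n = p + q'" using n by simp
    have "Suc n - p = q" "Suc n - 1 = n" using n by auto
    with binomial_absorb_comp[of "Suc n" p] have "Suc n * (n choose p) = (Suc n choose p) * q"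
      by (simp only: mult.commute[of q])
    from arg_cong[OF this, of real]
    have "real (Suc n) * real (n choose p) = real (Suc n choose p) * real q"
      by (simp only: of_nat_mult)
    moreover have "coeff (moment_poly n) p = real (n choose p) * moment p (q - 1)"
      using \<open>n = p + q'\<close> Suc by (simp add: coeff_moment_poly)
    ultimately show ?thesis by (simp only: mult.assoc[symmetric])
  qed (use n in \<open>simp add: coeff_moment_poly\<close>)
  have 2: "real (Suc n) * (if p = 0 then 0 else coeff (moment_poly n) (p - 1)) = real (Suc n choose p) * (real p * moment (p - 1) q)"
  proof (cases p)
    case (Suc p')
    then have "n = p' + q" using n by simp
    have "Suc n * (n choose p') = (Suc n choose p) * p"
      using Suc_times_binomial[of p' n] Suc by (simp only: mult.commute)
    from arg_cong[OF this, of real]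
    have "real (Suc n) * real (n choose p') = real (Suc n choose p) * real p"
      by (simp only: of_nat_mult)
    moreover have "(if p = 0 then 0 else coeff (moment_poly n) (p - 1)) = real (n choose p') * moment (p - 1) q"
      using \<open>n = p' + q\<close> Suc by (simp add: coeff_moment_poly)
    ultimately show ?thesis by (simp only: mult.assoc[symmetric])
  qed simp
  have "real (Suc n choose p) * moment (Suc p) q =
     r * (real (Suc n) * coeff (moment_poly n) p) + real (Suc n) * (if p = 0 then 0 else coeff (moment_poly n) (p - 1))"
    using eq by (subst (asm) mult_cancel_left) (simp add: algebra_simps)
  also have "\<dots> = real (Suc n choose p) * (real p * moment (p - 1) q + r * real q * moment p (q - 1))"
    unfolding 1 2 by (simp add: algebra_simps)
  finally show ?thesis using n by (subst (asm) mult_cancel_left) simp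
qed

section \<open>Stein's identity and orthogonality of Hermite polynomials\<close>

definition pair_mean :: "real poly \<Rightarrow> real poly \<Rightarrow> real" where
  "pair_mean f g = expectation (\<lambda>\<omega>. poly f (X \<omega>) * poly g (Y \<omega>))"

lemma integrable_poly_poly: "integrable M (\<lambda>\<omega>. poly f (X \<omega>) * poly g (Y \<omega>))"
proof -
  have "integrable M (\<lambda>\<omega>. (\<Sum>i\<le>degree f. \<Sum>j\<le>degree g. (coeff f i * coeff g j) * (X \<omega> ^ i * Y \<omega> ^ j)))"
    by (intro Bochner_Integration.integrable_sum integrable_mult_right integrable_monomial)
  then show ?thesis by (simp add: poly_altdef sum_product ac_simps)
qed

lemma pair_mean_add: "pair_mean (f + f') g = pair_mean f g + pair_mean f' g"
  "pair_mean f (g + g') = pair_mean f g + pair_mean f g'"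
  unfolding pair_mean_def by (simp_all add: distrib_left distrib_right integrable_poly_poly)

lemma pair_mean_smult: "pair_mean (smult c f) g = c * pair_mean f g"
  "pair_mean f (smult c g) = c * pair_mean f g"
  unfolding pair_mean_def by (simp_all add: mult.assoc mult.left_commute)

lemma pair_mean_monom: "pair_mean (monom a i) (monom b j) = a * b * moment i j"
proof -
  have "pair_mean (monom a i) (monom b j) = expectation (\<lambda>\<omega>. (a * b) * (X \<omega> ^ i * Y \<omega> ^ j))"
    unfolding pair_mean_def by (simp add: poly_monom ac_simps)
  then show ?thesis by (simp add: moment_def)
qed

lemma pair_mean_diff: "pair_mean (f - f') g = pair_mean f g - pair_mean f' g"
  using pair_mean_add(1)[of "f - f'" f' g] by simp

lemma pair_mean_sum:
  "pair_mean (sum f I) g = (\<Sum>i\<in>I. pair_mean (f i) g)"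
  "pair_mean g (sum f I) = (\<Sum>i\<in>I. pair_mean g (f i))"
proof -
  have 0: "pair_mean 0 g = 0" "pair_mean g 0 = 0" by (simp_all add: pair_mean_def)
  show "pair_mean (sum f I) g = (\<Sum>i\<in>I. pair_mean (f i) g)"
    by (induction I rule: infinite_finite_induct) (simp_all add: 0 pair_mean_add)
  show "pair_mean g (sum f I) = (\<Sum>i\<in>I. pair_mean g (f i))"
    by (induction I rule: infinite_finite_induct) (simp_all add: 0 pair_mean_add)
qed

text \<open>Gaussian integration by parts. Both sides are bilinear in \<open>f\<close> and
  \<open>g\<close>, so the monomial case \<open>moment_Suc\<close> suffices.\<close>

lemma stein:
  "pair_mean (pCons 0 f) g = pair_mean (pderiv f) g + r * pair_mean f (pderiv g)"
proof -
  let ?P = "\<lambda>f g. pair_mean (pCons 0 f) g = pair_mean (pderiv f) g + r * pair_mean f (pderiv g)"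
  have [simp]: "pair_mean 0 g = 0" "pair_mean f 0 = 0" for f g by (simp_all add: pair_mean_def)
  have mono: "?P (monom a i) (monom b j)" for a b i j
    using moment_Suc[of i j]
    by (cases i; cases j) (simp_all add: monom_Suc[symmetric] pderiv_monom pair_mean_monom algebra_simps)
  have add: "?P (f + f') g" if "?P f g" "?P f' g" for f f' g
  proof -
    have "pCons 0 (f + f') = pCons 0 f + pCons 0 f'" by simp
    with that show ?thesis by (simp only: pderiv_add pair_mean_add) (simp add: algebra_simps)
  qed
  have add2: "?P f (g + g')" if "?P f g" "?P f g'" for f g g'
    using that by (simp only: pderiv_add pair_mean_add) (simp add: algebra_simps)
  have "?P (\<Sum>i\<le>n. monom (coeff f i) i) (monom b j)" for n b j
    by (induction n) (simp_all add: mono add del: pCons_0_0)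
  from this[of "degree f"] have "?P f (monom b j)" for b j by (simp add: poly_as_sum_of_monoms)
  then have "?P f (\<Sum>i\<le>n. monom (coeff g i) i)" for n
    by (induction n) (simp_all add: add2)
  from this[of "degree g"] show ?thesis by (simp add: poly_as_sum_of_monoms)
qed

text \<open>The term \<open>pderiv (hermite_poly p)\<close> subtracted in the recursion cancels the
  first term of Stein's identity exactly; only the derivative of the other factor remains.\<close>

lemma pair_mean_hermite_Suc: "pair_mean (hermite_poly (Suc p)) g = r * pair_mean (hermite_poly p) (pderiv g)"
  using stein[of "hermite_poly p" g] by (simp add: pair_mean_diff)

text \<open>Each step lowers both indices by one and yields a factor \<open>r\<close> and, by the
  Appell property, the current index. If the indices differ, the descent ends with a constant
  against a Hermite polynomial of positive order, whose mean is zero.\<close>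

lemma pair_mean_hermite:
  "pair_mean (hermite_poly p) (hermite_poly q) = (if p = q then fact q * r ^ q else 0)"
proof (induction p arbitrary: q)
  case 0
  show ?case
  proof (cases q)
    case 0
    then show ?thesis by (simp add: pair_mean_def prob_space)
  next
    case (Suc q')
    \<comment> \<open>\<open>Y\<close> has to play the first role in Stein's identity here.\<close>
    interpret swap: gaussian_pair M Y X r by (rule swap)
    have "pair_mean 1 (hermite_poly (Suc q')) = swap.pair_mean (hermite_poly (Suc q')) 1"
      unfolding pair_mean_def swap.pair_mean_def by (simp only: mult.commute)
    also have "\<dots> = 0" unfolding swap.pair_mean_hermite_Suc by (simp add: swap.pair_mean_def)
    finally show ?thesis using Suc by simp
  qed
next
  case (Suc p)
  show ?case
  proof (cases q)
    case 0
    then show ?thesis unfolding pair_mean_hermite_Suc by (simp add: pair_mean_def)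
  next
    case (Suc q')
    then show ?thesis using Suc.IH[of q']
      unfolding pair_mean_hermite_Suc Suc pderiv_hermite_poly pair_mean_smult by simp
  qed
qed

end

lemma unit_gaussian_distr:
  assumes M: "prob_space M" and Z: "gaussian_rv M Z"
    and mean: "(\<integral>\<omega>. Z \<omega> \<partial>M) = 0" and var: "(\<integral>\<omega>. (Z \<omega>)\<^sup>2 \<partial>M) = 1"
  shows "distr M lborel Z = std_gaussian"
  using Z unfolding gaussian_rv_def
proof (elim disjE exE conjE)
  interpret prob_space M by fact
  fix \<mu> \<sigma> :: real
  assume \<sigma>: "0 < \<sigma>" and D: "distributed M lborel Z (\<lambda>x. ennreal (normal_density \<mu> \<sigma> x))"
  have "\<mu> = 0" using mean distributed_integral[OF D, of "\<lambda>x. x"] integral_normal_moment_nz_1[OF \<sigma>, of \<mu>]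
    by simp
  moreover from this have "\<sigma>\<^sup>2 = 1"
    using var distributed_integral[OF D, of "\<lambda>x. x ^ 2"] integral_normal_moment_even[OF \<sigma>, of 0 1] by simp
  then have "\<sigma> = 1" using \<sigma> by (simp add: power2_eq_1_iff)
  ultimately show ?thesis
    using distributed_distr_eq_density[OF D] by (simp add: std_gaussian_def)
next
  interpret prob_space M by fact
  fix \<mu> assume [measurable]: "Z \<in> borel_measurable M" and AE: "AE \<omega> in M. Z \<omega> = \<mu>"
  have "expectation Z = expectation (\<lambda>_. \<mu>)" using AE by (intro integral_cong_AE) auto
  moreover have "expectation (\<lambda>\<omega>. (Z \<omega>)\<^sup>2) = expectation (\<lambda>_. \<mu>\<^sup>2)" using AE by (intro integral_cong_AE) auto
  \<comment> \<open>The degenerate case is contradictory: mean zero forces \<open>\<mu> = 0\<close>,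
    second moment one forces the square of \<open>\<mu>\<close> to be 1.\<close>
  ultimately show ?thesis using mean var by (simp add: prob_space)
qed

context gaussian_pair
begin

text \<open>At \<open>r = 1\<close> the covariance formulas turn into Parseval's identity, and joint
  integrability turns into square integrability of one variable.\<close>

lemma diagonal: "gaussian_pair M X X 1"
proof
  show "gaussian_rv M (\<lambda>\<omega>. u * X \<omega> + v * X \<omega>)" for u v
    using gaussian[of "u + v" 0] by (simp add: distrib_right)
qed (use mean_X var_X in \<open>simp_all add: power2_eq_square\<close>)

lemma distr_X: "distr M lborel X = std_gaussian"
  using gaussian_XY mean_X var_X by (intro unit_gaussian_distr prob_space_axioms)

lemma integral_X: "F \<in> borel_measurable borel \<Longrightarrow> (\<integral>\<omega>. F (X \<omega>) \<partial>M) = (\<integral>x. F x \<partial>std_gaussian)" for F :: "real \<Rightarrow> real"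
  unfolding distr_X[symmetric] by (simp add: integral_distr)

lemma integrable_X: "F \<in> borel_measurable borel \<Longrightarrow> integrable M (\<lambda>\<omega>. F (X \<omega>)) \<longleftrightarrow> integrable std_gaussian F" for F :: "real \<Rightarrow> real"
  unfolding distr_X[symmetric] by (simp add: integrable_distr_eq)

lemma cov_le_1: "\<bar>r\<bar> \<le> 1"
  using integral_Cauchy_Schwarz[of X M Y] integrable_power_XY[of 2] by (simp add: var_X var_Y cov)

end

section \<open>Hermite expansions of square-integrable functions\<close>

lemma measurable_poly [measurable]: "poly (p :: real poly) \<in> borel_measurable borel"
  by (intro borel_measurable_continuous_onI continuous_intros)

lemma measurable_hermite [measurable]: "hermite q \<in> borel_measurable borel"
proof -
  have "hermite q = poly (hermite_poly q)" by (simp add: fun_eq_iff hermite_eq_poly)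
  then show ?thesis by simp
qed

text \<open>The starting order is a parameter because the notion is applied to \<open>G\<close> at
  order \<open>m\<close> and to its remainder at order \<open>Suc m\<close>, with the same
  coefficients; \<open>c\<close> absorbs the factorial.\<close>

definition hermite_series :: "(real \<Rightarrow> real) \<Rightarrow> nat \<Rightarrow> (nat \<Rightarrow> real) \<Rightarrow> bool" where
  "hermite_series g k c \<longleftrightarrow> L2_gaussian g \<and>
     (\<lambda>N. \<integral>x. (g x - (\<Sum>q=k..N. c q * hermite q x))\<^sup>2 \<partial>std_gaussian) \<longlonglongrightarrow> 0"

context gaussian_pair
begin

lemma hermite_sum_poly: "(\<Sum>q=k..N. c q * hermite q x) = poly (\<Sum>q=k..N. smult (c q) (hermite_poly q)) x"
  by (simp add: hermite_eq_poly poly_sum)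

lemma square_integrable_poly: "integrable M (\<lambda>\<omega>. (poly f (X \<omega>))\<^sup>2)"
proof -
  interpret diag: gaussian_pair M X X 1 by (rule diagonal)
  show ?thesis using diag.integrable_poly_poly[of f f] by (simp add: power2_eq_square)
qed

lemma hermite_series_X:
  assumes g: "hermite_series g k c"
  shows "(\<lambda>\<omega>. g (X \<omega>)) \<in> borel_measurable M" "integrable M (\<lambda>\<omega>. (g (X \<omega>))\<^sup>2)"
    "(\<lambda>N. \<integral>\<omega>. (g (X \<omega>) - poly (\<Sum>q=k..N. smult (c q) (hermite_poly q)) (X \<omega>))\<^sup>2 \<partial>M) \<longlonglongrightarrow> 0"
proof -
  have [measurable]: "g \<in> borel_measurable borel" and int: "integrable std_gaussian (\<lambda>x. (g x)\<^sup>2)"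
    using g by (auto simp: hermite_series_def L2_gaussian_def)
  show "(\<lambda>\<omega>. g (X \<omega>)) \<in> borel_measurable M" by measurable
  show "integrable M (\<lambda>\<omega>. (g (X \<omega>))\<^sup>2)" using int by (subst integrable_X) simp_all
  have "(\<integral>\<omega>. (g (X \<omega>) - poly p (X \<omega>))\<^sup>2 \<partial>M) = (\<integral>x. (g x - poly p x)\<^sup>2 \<partial>std_gaussian)" for p
    by (rule integral_X) measurable
  then show "(\<lambda>N. \<integral>\<omega>. (g (X \<omega>) - poly (\<Sum>q=k..N. smult (c q) (hermite_poly q)) (X \<omega>))\<^sup>2 \<partial>M) \<longlonglongrightarrow> 0"
    using g by (simp add: hermite_series_def hermite_sum_poly)
qed

lemma pair_mean_hermite_sums:
  "pair_mean (\<Sum>q=k..N. smult (c q) (hermite_poly q)) (\<Sum>q=k..N. smult (c q) (hermite_poly q)) =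
    (\<Sum>q=k..N. (c q)\<^sup>2 * fact q * r ^ q)"
proof -
  have "pair_mean (\<Sum>q=k..N. smult (c q) (hermite_poly q)) (\<Sum>q=k..N. smult (c q) (hermite_poly q)) =
     (\<Sum>p=k..N. \<Sum>q=k..N. if p = q then c p * (c q * (fact q * r ^ q)) else 0)"
    by (simp add: pair_mean_sum pair_mean_smult pair_mean_hermite if_distrib cong: if_cong)
  also have "\<dots> = (\<Sum>p=k..N. c p * (c p * (fact p * r ^ p)))"
    by (intro sum.cong refl) (simp add: sum.delta)
  finally show ?thesis by (simp add: power2_eq_square ac_simps)
qed

text \<open>The covariance becomes a power series in \<open>r\<close> whose coefficients are
  nonnegative and do not depend on the pair. That is what allows covariances at different
  \<open>r\<close> to be compared.\<close>

lemma pair_mean_series_tendsto: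
  assumes g: "hermite_series g k c"
  shows "(\<lambda>N. \<Sum>q=k..N. (c q)\<^sup>2 * fact q * r ^ q) \<longlonglongrightarrow> expectation (\<lambda>\<omega>. g (X \<omega>) * g (Y \<omega>))"
proof -
  interpret swap: gaussian_pair M Y X r by (rule swap)
  show ?thesis unfolding pair_mean_hermite_sums[symmetric] pair_mean_def
    using hermite_series_X[OF g] swap.hermite_series_X[OF g] square_integrable_poly swap.square_integrable_poly
    by (intro L2_inner_tendsto) simp_all
qed

text \<open>Since |r| is at most 1, every power of order at least \<open>k\<close> is bounded by
  \<open>\<bar>r\<bar> ^ k\<close>; the series left over is the one at \<open>r = 1\<close>, namely
  the squared norm of \<open>g\<close>.\<close>

lemma hermite_rank_covariance_bound:
  assumes g: "hermite_series g k c"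
  shows "\<bar>expectation (\<lambda>\<omega>. g (X \<omega>) * g (Y \<omega>))\<bar> \<le> \<bar>r\<bar> ^ k * (\<integral>x. (g x)\<^sup>2 \<partial>std_gaussian)"
proof -
  interpret diag: gaussian_pair M X X 1 by (rule diagonal)
  have gm: "g \<in> borel_measurable borel" using g by (auto simp: hermite_series_def L2_gaussian_def)
  have "\<bar>\<Sum>q=k..N. (c q)\<^sup>2 * fact q * r ^ q\<bar> \<le> \<bar>r\<bar> ^ k * (\<Sum>q=k..N. (c q)\<^sup>2 * fact q * 1 ^ q)" for N
  proof -
    have "\<bar>\<Sum>q=k..N. (c q)\<^sup>2 * fact q * r ^ q\<bar> \<le> (\<Sum>q=k..N. \<bar>(c q)\<^sup>2 * fact q * r ^ q\<bar>)" by (rule sum_abs)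
    also have "\<dots> \<le> (\<Sum>q=k..N. \<bar>r\<bar> ^ k * ((c q)\<^sup>2 * fact q * 1 ^ q))"
    proof (rule sum_mono)
      fix q assume "q \<in> {k..N}"
      then have "\<bar>r\<bar> ^ q \<le> \<bar>r\<bar> ^ k" using cov_le_1 by (intro power_decreasing) simp_all
      then have "(c q)\<^sup>2 * fact q * \<bar>r\<bar> ^ q \<le> (c q)\<^sup>2 * fact q * \<bar>r\<bar> ^ k" by (intro mult_left_mono) simp_all
      then show "\<bar>(c q)\<^sup>2 * fact q * r ^ q\<bar> \<le> \<bar>r\<bar> ^ k * ((c q)\<^sup>2 * fact q * 1 ^ q)"
        by (simp add: abs_mult power_abs mult.commute)
    qed
    finally show ?thesis by (simp add: sum_distrib_left)
  qed
  moreover have "(\<lambda>N. \<bar>\<Sum>q=k..N. (c q)\<^sup>2 * fact q * r ^ q\<bar>) \<longlonglongrightarrow> \<bar>expectation (\<lambda>\<omega>. g (X \<omega>) * g (Y \<omega>))\<bar>"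
    by (intro tendsto_rabs pair_mean_series_tendsto g)
  moreover have "(\<lambda>N. \<bar>r\<bar> ^ k * (\<Sum>q=k..N. (c q)\<^sup>2 * fact q * 1 ^ q)) \<longlonglongrightarrow>
      \<bar>r\<bar> ^ k * expectation (\<lambda>\<omega>. g (X \<omega>) * g (X \<omega>))"
    by (intro tendsto_mult_left diag.pair_mean_series_tendsto g)
  moreover have "expectation (\<lambda>\<omega>. g (X \<omega>) * g (X \<omega>)) = (\<integral>x. (g x)\<^sup>2 \<partial>std_gaussian)"
    using integral_X[of "\<lambda>x. (g x)\<^sup>2"] gm by (simp add: power2_eq_square)
  ultimately show ?thesis by (intro LIMSEQ_le) auto
qed

text \<open>Each partial sum is orthogonal to the lower polynomial, and this passes to the limit.
  The case \<open>j = 0\<close> centres \<open>G\<close>; the case \<open>j = m\<close> decouples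
  the remainder from the part carried by \<open>hermite m\<close>.\<close>

lemma hermite_rank_orthogonal:
  assumes g: "hermite_series g k c" and j: "j < k"
  shows "expectation (\<lambda>\<omega>. g (X \<omega>) * hermite j (Y \<omega>)) = 0"
proof -
  interpret swap: gaussian_pair M Y X r by (rule swap)
  have "(\<lambda>N. expectation (\<lambda>\<omega>. poly (\<Sum>q=k..N. smult (c q) (hermite_poly q)) (X \<omega>) * poly (hermite_poly j) (Y \<omega>)))
     \<longlonglongrightarrow> expectation (\<lambda>\<omega>. g (X \<omega>) * poly (hermite_poly j) (Y \<omega>))"
    using hermite_series_X[OF g] square_integrable_poly swap.square_integrable_poly
    by (intro L2_inner_tendsto) simp_all
  moreover have "pair_mean (\<Sum>q=k..N. smult (c q) (hermite_poly q)) (hermite_poly j) = 0" for N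
    using j by (simp add: pair_mean_sum pair_mean_smult pair_mean_hermite)
  ultimately show ?thesis
    by (simp add: pair_mean_def hermite_eq_poly LIMSEQ_const_iff)
qed

lemma expectation_hermite_hermite:
  "expectation (\<lambda>\<omega>. hermite q (X \<omega>) * hermite q (Y \<omega>)) = fact q * r ^ q"
  using pair_mean_hermite[of q q] by (simp add: pair_mean_def hermite_eq_poly)

lemma square_integrable_hermite: "integrable M (\<lambda>\<omega>. (hermite q (X \<omega>))\<^sup>2)"
  using square_integrable_poly by (simp add: hermite_eq_poly)

end

lemma hermite_series_of_rank:
  assumes "has_hermite_rank G m"
  shows "hermite_series G m (\<lambda>q. hermite_coeff G q / fact q)"
  using assms by (simp add: has_hermite_rank_def hermite_series_def)

text \<open>The variable \<open>X\<close> serves as a realisation of the Gaussian measure, through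
  which square integrability of \<open>hermite m\<close> is transported. For
  \<open>N \<ge> m\<close> the new error is the old one with its first term regrouped.\<close>

lemma (in gaussian_pair) hermite_series_remainder:
  assumes G: "has_hermite_rank G m"
  shows "hermite_series (\<lambda>x. G x - hermite_coeff G m / fact m * hermite m x) (Suc m)
    (\<lambda>q. hermite_coeff G q / fact q)"
proof -
  let ?c = "\<lambda>q. hermite_coeff G q / fact q"
  have [measurable]: "G \<in> borel_measurable borel" and int: "integrable std_gaussian (\<lambda>x. (G x)\<^sup>2)"
    and lim: "(\<lambda>N. \<integral>x. (G x - (\<Sum>q=m..N. ?c q * hermite q x))\<^sup>2 \<partial>std_gaussian) \<longlonglongrightarrow> 0"
    using G by (auto simp: has_hermite_rank_def L2_gaussian_def)
  have "integrable M (\<lambda>\<omega>. (G (X \<omega>))\<^sup>2)" using int by (subst integrable_X) simp_all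
  moreover have "integrable M (\<lambda>\<omega>. (?c m * hermite m (X \<omega>))\<^sup>2)"
    unfolding power_mult_distrib by (intro integrable_mult_right square_integrable_hermite)
  ultimately have "integrable M (\<lambda>\<omega>. (G (X \<omega>) - ?c m * hermite m (X \<omega>))\<^sup>2)"
    by (intro integrable_square_diff) simp_all
  then have "L2_gaussian (\<lambda>x. G x - ?c m * hermite m x)"
    unfolding L2_gaussian_def by (subst (asm) integrable_X[of "\<lambda>x. (G x - ?c m * hermite m x)\<^sup>2"]) simp_all
  moreover have "(\<lambda>N. \<integral>x. (G x - ?c m * hermite m x - (\<Sum>q=Suc m..N. ?c q * hermite q x))\<^sup>2 \<partial>std_gaussian) \<longlonglongrightarrow> 0"
  proof (rule Lim_transform_eventually[OF lim])
    show "\<forall>\<^sub>F N in sequentially. (\<integral>x. (G x - (\<Sum>q=m..N. ?c q * hermite q x))\<^sup>2 \<partial>std_gaussian) =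
       (\<integral>x. (G x - ?c m * hermite m x - (\<Sum>q=Suc m..N. ?c q * hermite q x))\<^sup>2 \<partial>std_gaussian)"
      using eventually_ge_at_top[of m] by eventually_elim (simp add: sum.atLeast_Suc_atMost diff_diff_eq)
  qed
  ultimately show ?thesis unfolding hermite_series_def by blast
qed

subsection \<open>Slowly varying functions\<close>

text \<open>A set of measure less than \<open>1/2\<close> and a translate of another such set cannot cover
  \<open>{1..2}\<close>; the common good point links \<open>h x\<close> with \<open>h (x + u)\<close>.\<close>

lemma uniform_convergence_additive:
  fixes h :: "real \<Rightarrow> real"
  assumes [measurable]: "h \<in> borel_measurable borel"
    and lim: "\<And>u. ((\<lambda>x. h (x + u) - h x) \<longlongrightarrow> 0) at_top" and e: "e > 0"
  shows "\<forall>\<^sub>F x in at_top. \<forall>u\<in>{0..1}. \<bar>h (x + u) - h x\<bar> < e"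
proof -
  \<comment> \<open>The window has length 2 so that for \<open>u\<close> in \<open>{0..1}\<close>
    both it and its translate by \<open>u\<close> contain \<open>{1..2}\<close>. Convergence for
    each fixed shift then gives small measure of the bad set by dominated convergence.\<close>
  define B where "B x = {t \<in> {0..2}. e / 2 \<le> \<bar>h (x + t) - h x\<bar>}" for x
  have B [measurable]: "B x \<in> sets borel" for x unfolding B_def by measurable
  have "((\<lambda>x. \<integral>t. (indicator (B x) t :: real) \<partial>lborel) \<longlongrightarrow> (\<integral>t. 0 \<partial>(lborel :: real measure))) at_top"
  proof (rule integral_dominated_convergence_at_top[where w = "indicator {0..2}"])
    show "integrable lborel (indicator {0..2::real} :: real \<Rightarrow> real)" by (simp add: integrable_indicator_iff)
    show "\<forall>\<^sub>F x in at_top. AE t in lborel. norm (indicator (B x) t :: real) \<le> indicator {0..2} t"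
      by (intro always_eventually allI AE_I2) (auto simp: indicator_def B_def)
    show "AE t in lborel. ((\<lambda>x. indicator (B x) t :: real) \<longlongrightarrow> 0) at_top"
    proof (rule AE_I2, rule tendsto_eventually)
      fix t :: real
      have "\<forall>\<^sub>F x in at_top. \<bar>h (x + t) - h x\<bar> < e / 2"
        using tendstoD[OF lim[of t], of "e / 2"] e by (simp add: dist_real_def)
      then show "\<forall>\<^sub>F x in at_top. (indicator (B x) t :: real) = 0"
        by eventually_elim (auto simp: B_def)
    qed
  qed (use B in \<open>auto intro!: borel_measurable_indicator\<close>)
  then have "((\<lambda>x. measure lborel (B x)) \<longlongrightarrow> 0) at_top" by simp
  then have "\<forall>\<^sub>F x in at_top. measure lborel (B x) < 1 / 2"
    by (rule order_tendstoD) simp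
  then obtain x0 where x0: "\<And>x. x \<ge> x0 \<Longrightarrow> measure lborel (B x) < 1 / 2"
    unfolding eventually_at_top_linorder by blast
  have "\<bar>h (x + u) - h x\<bar> < e" if "x \<ge> x0" "u \<in> {0..1}" for x u
  proof -
    define C where "C = (\<lambda>t. u + t) ` B (x + u)"
    have C: "C = (\<lambda>t. t - u) -` B (x + u)" unfolding C_def by force
    have Cm: "C \<in> sets borel"
      unfolding C using measurable_sets[of "\<lambda>t. t - u" borel borel "B (x + u)"] by simp
    have fin: "emeasure lborel (B y) < \<infinity>" for y
    proof -
      have "emeasure lborel (B y) \<le> emeasure lborel {0..2::real}"
        by (intro emeasure_mono) (auto simp: B_def)
      also have "\<dots> < \<infinity>" by simp
      finally show ?thesis .
    qed
    have mC: "emeasure lborel C = emeasure lborel (B (x + u))"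
    proof -
      have "emeasure lborel C = emeasure (distr lborel borel ((+) (-u))) (B (x + u))"
        unfolding C by (subst emeasure_distr) (auto simp: vimage_def)
      then show ?thesis by (simp only: lborel_distr_plus)
    qed
    have "emeasure lborel (B y) < ennreal (1 / 2)" if "y \<ge> x0" for y
    proof -
      have "emeasure lborel (B y) = ennreal (measure lborel (B y))"
        using fin[of y] by (intro emeasure_eq_ennreal_measure) (simp only: infinity_ennreal_def order_less_irrefl not_False_eq_True less_top)
      also have "\<dots> < ennreal (1 / 2)" using x0[OF that] by (intro ennreal_lessI) simp_all
      finally show ?thesis .
    qed
    then have "emeasure lborel (B x) < ennreal (1 / 2)" "emeasure lborel (B (x + u)) < ennreal (1 / 2)"
      using that by simp_all
    then have "emeasure lborel (B x \<union> C) < ennreal (1 / 2) + ennreal (1 / 2)"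
      using emeasure_subadditive[of "B x" lborel C] Cm mC by (auto intro: order_le_less_trans add_strict_mono)
    also have "\<dots> = ennreal 1" by (subst ennreal_plus[symmetric]) simp_all
    also have "\<dots> = emeasure lborel {1..2::real}" by simp
    finally have "\<not> {1..2} \<subseteq> B x \<union> C"
      using emeasure_mono[of "{1..2}" "B x \<union> C" lborel] Cm by force
    then obtain t where t: "t \<in> {1..2}" "t \<notin> B x" "t \<notin> C" by blast
    from t have "\<bar>h (x + t) - h x\<bar> < e / 2" by (auto simp: B_def)
    moreover from t that have "\<bar>h (x + t) - h (x + u)\<bar> < e / 2"
      unfolding C by (auto simp: B_def)
    ultimately show ?thesis by linarith
  qed
  then show ?thesis unfolding eventually_at_top_linorder by blast
qed

text \<open>Unit steps change \<open>h\<close> by less than \<open>e / 2\<close> each, which gives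
  slope \<open>e / 2\<close> up to an additive constant; the other half of \<open>e\<close> absorbs
  that constant once \<open>x \<ge> 2 * b / e\<close>.\<close>

lemma sublinear_growth:
  fixes h :: "real \<Rightarrow> real"
  assumes "\<forall>\<^sub>F x in at_top. \<forall>u\<in>{0..1}. \<bar>h (x + u) - h x\<bar> < e / 2" and e: "e > 0"
  shows "\<forall>\<^sub>F x in at_top. \<bar>h x\<bar> \<le> e * x"
proof -
  from assms obtain x0 where x0: "\<And>x u. x \<ge> x0 \<Longrightarrow> u \<in> {0..1} \<Longrightarrow> \<bar>h (x + u) - h x\<bar> < e / 2"
    unfolding eventually_at_top_linorder by blast
  have steps: "\<bar>h (x0 + real n) - h x0\<bar> \<le> e / 2 * real n" for n
  proof (induction n)
    case (Suc n)
    have "x0 + real (Suc n) = x0 + real n + 1" "e / 2 * real (Suc n) = e / 2 * real n + e / 2"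
      by (simp_all add: algebra_simps)
    then show ?case using Suc x0[of "x0 + real n" 1] by (simp only:) (smt (verit) atLeastAtMost_iff of_nat_0_le_iff)
  qed simp
  define b where "b = \<bar>h x0\<bar> + e / 2 * (1 - x0)"
  have bound: "\<bar>h x\<bar> \<le> b + e / 2 * x" if "x \<ge> x0" for x
  proof -
    define n where "n = nat \<lfloor>x - x0\<rfloor>"
    have n: "real n \<le> x - x0" "x - x0 < real n + 1" using that unfolding n_def by linarith+
    have "\<bar>h x - h (x0 + real n)\<bar> < e / 2" using x0[of "x0 + real n" "x - x0 - real n"] n by simp
    moreover have "e / 2 * real n \<le> e / 2 * (x - x0)" using n e by (intro mult_left_mono) auto
    ultimately have "\<bar>h x\<bar> \<le> \<bar>h x0\<bar> + e / 2 + e / 2 * (x - x0)" using steps[of n] by linarith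
    then show ?thesis by (simp add: b_def algebra_simps diff_divide_distrib)
  qed
  have "\<forall>\<^sub>F x in at_top. x \<ge> x0 \<and> x \<ge> 2 * b / e"
    by (intro eventually_conj eventually_ge_at_top)
  then show ?thesis
  proof eventually_elim
    case (elim x)
    then have "b \<le> e / 2 * x" using e by (simp add: field_simps)
    then show ?case using bound[of x] elim by (simp add: field_simps)
  qed
qed

text \<open>In logarithmic coordinates, \<open>h x = ln (L (exp x))\<close>, slow variation says
  that increments over fixed shifts vanish. Hence \<open>h\<close> grows sublinearly, and
  exponentiating back bounds \<open>L\<close> by small powers.\<close>

lemma slowly_varying_powr_bounds:
  assumes L: "slowly_varying L" and e: "e > 0"
  shows "\<forall>\<^sub>F x in at_top. x powr (- e) \<le> L x \<and> L x \<le> x powr e"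
proof -
  note [measurable] = L[unfolded slowly_varying_def, THEN conjunct1]
  have pos: "\<forall>\<^sub>F x in at_top. 0 < L x" using L by (simp add: slowly_varying_def)
  define h where "h x = ln (L (exp x))" for x
  have h [measurable]: "h \<in> borel_measurable borel" unfolding h_def by measurable
  have "((\<lambda>x. h (x + u) - h x) \<longlongrightarrow> 0) at_top" for u
  proof -
    have "((\<lambda>x. L (exp u * x) / L x) \<longlongrightarrow> 1) at_top" using L by (simp add: slowly_varying_def)
    then have *: "((\<lambda>x. ln (L (exp u * exp x) / L (exp x))) \<longlongrightarrow> ln 1) at_top"
      by (intro tendsto_ln filterlim_compose[OF _ exp_at_top]) auto
    have "\<forall>\<^sub>F x in at_top. 0 < L (exp x)"
      using pos exp_at_top by (rule eventually_compose_filterlim)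
    moreover have "\<forall>\<^sub>F x in at_top. 0 < L (exp (x + u))"
      by (rule eventually_compose_filterlim[OF pos], rule filterlim_compose[OF exp_at_top])
        (subst add.commute, rule filterlim_tendsto_add_at_top[OF tendsto_const filterlim_ident])
    ultimately have "\<forall>\<^sub>F x in at_top. ln (L (exp u * exp x) / L (exp x)) = h (x + u) - h x"
      by eventually_elim (simp add: h_def ln_div exp_add mult.commute)
    from tendsto_cong[OF this] * show ?thesis by simp
  qed
  from sublinear_growth[OF uniform_convergence_additive[OF h this] e]
  have "\<forall>\<^sub>F x in at_top. \<bar>h x\<bar> \<le> e * x" using e by simp
  then have "\<forall>\<^sub>F x in at_top. \<bar>h (ln x)\<bar> \<le> e * ln x"
    using ln_at_top by (rule eventually_compose_filterlim)
  with pos eventually_gt_at_top[of 0] show ?thesis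
  proof eventually_elim
    case (elim x)
    then have "\<bar>ln (L x)\<bar> \<le> e * ln x" by (simp add: h_def)
    then have "exp (- e * ln x) \<le> exp (ln (L x))" "exp (ln (L x)) \<le> exp (e * ln x)" by simp_all
    with elim show ?case by (simp add: powr_def)
  qed
qed

text \<open>Half of \<open>e\<close> pays for the slowly varying factor; the other half absorbs
  \<open>c\<close> and the factors 2 and 1/2 lost in passing from asymptotic equivalence to
  inequalities.\<close>

lemma regularly_varying_powr_bounds:
  assumes \<rho>: "\<rho> \<sim>[at_top] (\<lambda>h. c * real h powr (- \<alpha>) * L (real h))"
    and "c > 0" and L: "slowly_varying L" and e: "e > 0"
  shows "\<forall>\<^sub>F h in sequentially. real h powr (- (\<alpha> + e)) \<le> \<rho> h \<and> \<rho> h \<le> real h powr (- (\<alpha> - e))"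
proof -
  have e2: "e / 2 > 0" using e by simp
  have "\<forall>\<^sub>F h in sequentially. real h powr (- (e / 2)) \<le> L (real h) \<and> L (real h) \<le> real h powr (e / 2)"
    using slowly_varying_powr_bounds[OF L e2] filterlim_real_sequentially by (rule eventually_compose_filterlim)
  moreover have "(\<lambda>h. real h powr (- (e / 2))) \<longlonglongrightarrow> 0"
    using e by (intro tendsto_neg_powr filterlim_real_sequentially) simp
  then have "\<forall>\<^sub>F h in sequentially. real h powr (- (e / 2)) < min (c / 2) (1 / (2 * c))"
    using \<open>c > 0\<close> by (intro order_tendstoD(2)) auto
  moreover have "\<forall>\<^sub>F h in sequentially. norm (\<rho> h) \<le> 2 * norm (c * real h powr (- \<alpha>) * L (real h))"
    using \<rho> by (rule asymp_equiv_imp_eventually_le) simp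
  moreover have "\<forall>\<^sub>F h in sequentially. norm (\<rho> h) \<ge> 1 / 2 * norm (c * real h powr (- \<alpha>) * L (real h))"
    using \<rho> by (rule asymp_equiv_imp_eventually_ge) simp
  \<comment> \<open>The two norm bounds leave the sign of \<open>\<rho> h\<close> open; this settles
    it.\<close>
  moreover have "\<forall>\<^sub>F h in sequentially. \<rho> h > 0 \<longleftrightarrow> c * real h powr (- \<alpha>) * L (real h) > 0"
    using \<rho> by (rule asymp_equiv_eventually_pos_iff)
  ultimately show ?thesis using eventually_gt_at_top[of 0]
  proof eventually_elim
    case (elim h)
    define x where "x = real h powr (- (e / 2))"
    define y where "y = real h powr (- \<alpha>)"
    have x: "x > 0" "y > 0" using elim by (simp_all add: x_def y_def)
    have inv: "real h powr (e / 2) = 1 / x" by (simp add: x_def powr_minus field_simps)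
    have L: "x \<le> L (real h)" "L (real h) \<le> 1 / x" "x < c / 2" "x * (2 * c) < 1"
      using elim \<open>c > 0\<close> by (simp_all add: x_def[symmetric] inv field_simps)
    have "L (real h) > 0" using L x by linarith
    then have pos: "c * y * L (real h) > 0" using x \<open>c > 0\<close> by simp
    then have \<rho>: "\<rho> h \<le> 2 * (c * y * L (real h))" "1 / 2 * (c * y * L (real h)) \<le> \<rho> h"
      using elim unfolding y_def[symmetric] by (simp_all del: zero_less_mult_iff mult_eq_0_iff add: abs_of_pos)
    have exps: "real h powr (- (\<alpha> + e)) = y * (x * x)" "real h powr (- (\<alpha> - e)) = y * ((1 / x) * (1 / x))"
      unfolding inv[symmetric] unfolding x_def y_def powr_add[symmetric] by (simp_all add: algebra_simps)
    have "y * (x * x) \<le> y * (c / 2 * L (real h))"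
      using L x by (intro mult_left_mono mult_mono) auto
    moreover have "y * (2 * c * L (real h)) \<le> y * ((1 / x) * (1 / x))"
    proof (intro mult_left_mono mult_mono)
      show "2 * c \<le> 1 / x" using L x by (simp add: field_simps)
    qed (use L x in auto)
    moreover have "y * (c / 2 * L (real h)) = 1 / 2 * (c * y * L (real h))"
      "y * (2 * c * L (real h)) = 2 * (c * y * L (real h))" by simp_all
    ultimately show ?case unfolding exps using \<rho> by linarith
  qed
qed

subsection \<open>Sums and quadratic forms of power size\<close>

text \<open>For \<open>e \<ge> 0\<close> one uses that x is at least N / B, otherwise that negative
  powers decrease and B is at least 1. The absolute value in the constant serves both signs of the
  exponent at once.\<close>

lemma powr_comparable:
  fixes x N B e :: real
  assumes "0 < x" "x \<le> N" "N \<le> B * x"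
  shows "B powr (- \<bar>e\<bar>) * N powr e \<le> x powr e"
proof -
  have "1 * x \<le> B * x" using assms by linarith
  then have "B \<ge> 1" using \<open>0 < x\<close> by (simp only: mult_le_cancel_right_pos)
  show ?thesis
  proof (cases "e \<ge> 0")
    case True
    have "B powr (- e) * N powr e = (N / B) powr e"
      using assms \<open>B \<ge> 1\<close> by (simp add: powr_divide powr_minus_divide)
    also have "\<dots> \<le> x powr e"
      using assms \<open>B \<ge> 1\<close> True by (intro powr_mono2) (simp_all add: divide_le_eq mult.commute)
    finally show ?thesis using True by simp
  next
    case False
    have "B powr (- \<bar>e\<bar>) * N powr e \<le> 1 * x powr e"
      using assms False \<open>B \<ge> 1\<close> powr_mono[of "- \<bar>e\<bar>" 0 B] by (intro mult_mono powr_mono2') simp_all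
    then show ?thesis by simp
  qed
qed

text \<open>Each term is compared with an increment of n^q by the mean value theorem, which treats
  increasing and decreasing summands alike.\<close>

lemma sum_powr_le:
  assumes q: "q > 0"
  shows "\<exists>C\<ge>0. \<forall>n. (\<Sum>t\<le>n. real t powr (q - 1)) \<le> C * real n powr q"
proof -
  \<comment> \<open>The factor q comes from the derivative of x^q, the power of 2 from replacing the
    intermediate point by \<open>Suc n\<close>, which is at most twice as large. Taking
    \<open>C\<close> at least \<open>1 / k\<close> runs the induction, and at least 1 starts it: the
    term at 0 vanishes and the term at 1 is 1.\<close>
  define k where "k = q * 2 powr (- \<bar>q - 1\<bar>)"
  have k: "k > 0" using q by (simp add: k_def)
  define C where "C = max 1 (1 / k)"
  have C: "C \<ge> 1" "C * k \<ge> 1" using k by (auto simp: C_def max_def field_simps)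
  have "(\<Sum>t\<le>n. real t powr (q - 1)) \<le> C * real n powr q" for n
  proof (induction n)
    case (Suc n)
    show ?case
    proof (cases "n = 0")
      case True
      then show ?thesis using C by simp
    next
      case False
      then have "\<exists>z>real n. z < real (Suc n) \<and>
          real (Suc n) powr q - real n powr q = (real (Suc n) - real n) * (q * z powr (q - 1))"
        using q by (intro MVT2) (auto intro!: derivative_eq_intros)
      then obtain z where z: "real n < z" "z < real (Suc n)"
        "real (Suc n) powr q - real n powr q = q * z powr (q - 1)" by auto
      have "2 powr (- \<bar>q - 1\<bar>) * real (Suc n) powr (q - 1) \<le> z powr (q - 1)"
        using z False by (intro powr_comparable) auto
      then have "k * real (Suc n) powr (q - 1) \<le> real (Suc n) powr q - real n powr q"
        using q z(3) by (simp add: k_def mult.assoc)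
      then have "C * (k * real (Suc n) powr (q - 1)) \<le> C * (real (Suc n) powr q - real n powr q)"
        using C by (intro mult_left_mono) auto
      moreover have "1 * real (Suc n) powr (q - 1) \<le> C * k * real (Suc n) powr (q - 1)"
        using C by (intro mult_right_mono) auto
      ultimately have "real (Suc n) powr (q - 1) \<le> C * real (Suc n) powr q - C * real n powr q"
        by (simp only: right_diff_distrib mult.assoc mult_1_left)
      then show ?thesis using Suc by (simp only: sum.atMost_Suc)
    qed
  qed simp
  then show ?thesis using C by (intro exI[of _ C]) auto
qed

text \<open>The finitely many terms outside the eventual bound contribute a constant, absorbed
  because n^q is at least 1.\<close>

lemma sum_le_powr:
  fixes f :: "nat \<Rightarrow> real"
  assumes q: "q > 0" and f: "\<And>t. 0 \<le> f t" and ev: "\<forall>\<^sub>F t in sequentially. f t \<le> real t powr (q - 1)"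
  shows "\<exists>C\<ge>0. \<forall>n\<ge>1. (\<Sum>t\<le>n. f t) \<le> C * real n powr q"
proof -
  from sum_powr_le[OF q] obtain C where C: "C \<ge> 0" "\<And>n. (\<Sum>t\<le>n. real t powr (q - 1)) \<le> C * real n powr q" by blast
  from ev obtain N where N: "\<And>t. t \<ge> N \<Longrightarrow> f t \<le> real t powr (q - 1)" by (auto simp: eventually_sequentially)
  define D where "D = (\<Sum>t<N. f t)"
  have D: "D \<ge> 0" by (simp add: D_def sum_nonneg f)
  have "(\<Sum>t\<le>n. f t) \<le> (C + D) * real n powr q" if "n \<ge> 1" for n
  proof -
    have "(\<Sum>t\<le>n. f t) \<le> (\<Sum>t\<le>n. real t powr (q - 1) + (if t < N then f t else 0))"
      using N by (intro sum_mono) auto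
    also have "\<dots> = (\<Sum>t\<le>n. real t powr (q - 1)) + (\<Sum>t\<in>{..n} \<inter> {t. t < N}. f t)"
      by (simp add: sum.distrib sum.If_cases)
    also have "(\<Sum>t\<in>{..n} \<inter> {t. t < N}. f t) \<le> D"
      unfolding D_def using f by (intro sum_mono2) auto
    also have "D \<le> D * real n powr q"
      using D q that by (simp add: mult_le_cancel_left1 ge_one_powr_ge_zero)
    finally show ?thesis using C(2)[of n] by (simp add: distrib_right)
  qed
  then show ?thesis using C D by (intro exI[of _ "C + D"]) auto
qed

text \<open>Schur's test: the product is at most half the sum of the two squares, and symmetry of
  \<open>w\<close> identifies the two resulting sums. It is used with powers of |\<rho>| for upper
  bounds on covariances and with 0/1 weights for discarding exceptional pairs.\<close>

lemma schur_bound: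
  fixes a :: "'i \<Rightarrow> real" and w :: "'i \<Rightarrow> 'i \<Rightarrow> real"
  assumes "\<And>s t. 0 \<le> w s t" "\<And>s t. w s t = w t s"
  shows "(\<Sum>s\<in>I. \<Sum>t\<in>I. w s t * \<bar>a s * a t\<bar>) \<le> (\<Sum>t\<in>I. (a t)\<^sup>2 * (\<Sum>s\<in>I. w s t))"
proof -
  have "w s t * \<bar>a s * a t\<bar> \<le> (w s t * (a s)\<^sup>2 + w s t * (a t)\<^sup>2) / 2" for s t
  proof -
    have "\<bar>a s * a t\<bar> \<le> ((a s)\<^sup>2 + (a t)\<^sup>2) / 2"
      using sum_squares_bound[of "\<bar>a s\<bar>" "\<bar>a t\<bar>"] by (simp add: abs_mult)
    then have "w s t * \<bar>a s * a t\<bar> \<le> w s t * (((a s)\<^sup>2 + (a t)\<^sup>2) / 2)" using assms by (intro mult_left_mono)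
    then show ?thesis by (simp add: algebra_simps)
  qed
  then have "(\<Sum>s\<in>I. \<Sum>t\<in>I. w s t * \<bar>a s * a t\<bar>) \<le> (\<Sum>s\<in>I. \<Sum>t\<in>I. (w s t * (a s)\<^sup>2 + w s t * (a t)\<^sup>2) / 2)"
    by (intro sum_mono)
  also have "\<dots> = ((\<Sum>s\<in>I. \<Sum>t\<in>I. w s t * (a s)\<^sup>2) + (\<Sum>s\<in>I. \<Sum>t\<in>I. w s t * (a t)\<^sup>2)) / 2"
    by (simp add: sum.distrib flip: sum_divide_distrib)
  also have "(\<Sum>s\<in>I. \<Sum>t\<in>I. w s t * (a t)\<^sup>2) = (\<Sum>t\<in>I. \<Sum>s\<in>I. w s t * (a t)\<^sup>2)" by (rule sum.swap)
  also have "(\<Sum>s\<in>I. \<Sum>t\<in>I. w s t * (a s)\<^sup>2) = (\<Sum>t\<in>I. \<Sum>s\<in>I. w s t * (a t)\<^sup>2)"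
    by (subst assms(2)) (rule refl)
  also have "(x + x) / 2 = x" for x :: real by simp
  also have "(\<Sum>t\<in>I. \<Sum>s\<in>I. w s t * (a t)\<^sup>2) = (\<Sum>t\<in>I. (a t)\<^sup>2 * (\<Sum>s\<in>I. w s t))"
    by (simp only: mult.commute[of "(a _)\<^sup>2"] sum_distrib_right)
  finally show ?thesis .
qed

text \<open>With truncated subtraction, \<open>(s - t) + (t - s)\<close> is the distance of \<open>s\<close> and \<open>t\<close>.\<close>

lemma sum_distance_le:
  fixes f :: "nat \<Rightarrow> real"
  assumes f: "\<And>h. 0 \<le> f h" and t: "t \<in> {u..<u + l}"
  shows "(\<Sum>s=u..<u + l. f ((s - t) + (t - s))) \<le> 2 * (\<Sum>h<l. f h)"
proof -
  have "(\<Sum>s\<in>{u..t}. f ((s - t) + (t - s))) = (\<Sum>s\<in>{u..t}. f (t - s))" by (intro sum.cong) auto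
  also have "\<dots> = sum f ((-) t ` {u..t})" by (subst sum.reindex) (auto simp: inj_on_def)
  also have "\<dots> \<le> (\<Sum>h<l. f h)" using t f by (intro sum_mono2) auto
  finally have 1: "(\<Sum>s\<in>{u..t}. f ((s - t) + (t - s))) \<le> (\<Sum>h<l. f h)" .
  have "(\<Sum>s\<in>{t<..<u + l}. f ((s - t) + (t - s))) = (\<Sum>s\<in>{t<..<u + l}. f (s - t))" by (intro sum.cong) auto
  also have "\<dots> = sum f ((\<lambda>s. s - t) ` {t<..<u + l})" by (subst sum.reindex) (auto simp: inj_on_def)
  also have "\<dots> \<le> (\<Sum>h<l. f h)" using t f by (intro sum_mono2) auto
  finally have 2: "(\<Sum>s\<in>{t<..<u + l}. f ((s - t) + (t - s))) \<le> (\<Sum>h<l. f h)" .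
  have "{u..<u + l} = {u..t} \<union> {t<..<u + l}" "{u..t} \<inter> {t<..<u + l} = {}" using t by auto
  then have "(\<Sum>s=u..<u + l. f ((s - t) + (t - s))) =
     (\<Sum>s\<in>{u..t}. f ((s - t) + (t - s))) + (\<Sum>s\<in>{t<..<u + l}. f ((s - t) + (t - s)))"
    by (simp only: sum.union_disjoint finite_atLeastAtMost finite_greaterThanLessThan)
  with 1 2 show ?thesis by linarith
qed

text \<open>The pairs \<open>(s, t)\<close> near the diagonal or the origin, where nothing is known about signs, are
  negligible; the block \<open>(n/4, n/2] \<times> (3n/4, n]\<close> alone already has the full order of magnitude.\<close>

lemma quadratic_form_lower_bound:
  fixes a \<rho> :: "nat \<Rightarrow> real" and \<delta> \<beta> p :: real
  assumes \<rho>1: "\<And>h. \<bar>\<rho> h\<bar> \<le> 1"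
    and a: "\<forall>\<^sub>F t in sequentially. real t powr (- \<delta>) \<le> a t"
    and \<rho>: "\<forall>\<^sub>F h in sequentially. real h powr (- \<beta>) \<le> \<rho> h" and \<beta>: "0 \<le> \<beta>"
    and sq: "\<And>n. n \<ge> 1 \<Longrightarrow> (\<Sum>t\<le>n. (a t)\<^sup>2) \<le> K * real n powr p"
    and \<theta>: "\<theta> = 2 - 2 * \<delta> - \<beta> * real m" "1 < \<theta>" "p < \<theta>"
  shows "\<exists>\<kappa>>0. \<forall>\<^sub>F n in sequentially. \<kappa> * real n powr \<theta> \<le>
    (\<Sum>s=1..n. \<Sum>t=1..n. a s * a t * \<rho> ((s - t) + (t - s)) ^ m)"
proof -
  from eventually_conj[OF a \<rho>] obtain N where N:
    "\<And>t. t \<ge> N \<Longrightarrow> real t powr (- \<delta>) \<le> a t" "\<And>h. h \<ge> N \<Longrightarrow> real h powr (- \<beta>) \<le> \<rho> h"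
    by (auto simp: eventually_sequentially)
  \<comment> \<open>The indicator of the exceptional pairs, on which the eventual lower bounds for
    \<open>a\<close> or \<open>\<rho>\<close> cannot be applied.\<close>
  define w where "w s t = (if s < N \<or> t < N \<or> (s - t) + (t - s) < N then 1 else 0 :: real)" for s t :: nat
  \<comment> \<open>Indices in the block lie between n/4 and n, so replacing them by n in a power
    with exponent \<open>- \<delta>\<close> costs at most this factor.\<close>
  define c where "c = 4 powr (- \<bar>- \<delta>\<bar>)"
  define D where "D = (\<Sum>t<N. (a t)\<^sup>2)"
  \<comment> \<open>For \<open>t \<ge> N\<close> a row has at most \<open>N\<close> exceptional
    entries below \<open>N\<close> and \<open>2 * N + 1\<close> close to \<open>t\<close>.\<close>
  define E where "E = real (3 * N + 1)"
  have c: "c > 0" by (simp add: c_def)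
  have nonneg: "a t \<ge> 0" "\<rho> t \<ge> 0" if "t \<ge> N" for t
    using N[OF that] powr_ge_zero order_trans by blast+
  have lower: "(c / 8)\<^sup>2 * real n powr \<theta> - (D * real n + E * K * real n powr p) \<le>
     (\<Sum>s=1..n. \<Sum>t=1..n. a s * a t * \<rho> ((s - t) + (t - s)) ^ m)" if n: "n \<ge> 4 * N + 4" for n
  proof -
    define k where "k = n div 4"
    have k: "4 * k \<le> n" "n < 4 * k + 4" "k \<ge> N" "k \<ge> 1" using n unfolding k_def by auto
    define g where "g = (c * real n powr (- \<delta>))\<^sup>2 * (real n powr (- \<beta>)) ^ m"
    have g: "g \<ge> 0" by (simp add: g_def)
    let ?I = "\<lambda>s t. (if s \<in> {k<..2 * k} \<and> t \<in> {3 * k<..4 * k} then g else 0)"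
    \<comment> \<open>Exceptional pairs lie outside the block and cost at most |a_s a_t| since
      |\<rho>| is at most 1. All other pairs contribute nonnegatively, and those in the block at
      least \<open>g\<close>: there the indices and their distance exceed \<open>k\<close>, which is
      at least \<open>N\<close>.\<close>
    have pt: "?I s t - w s t * \<bar>a s * a t\<bar> \<le> a s * a t * \<rho> ((s - t) + (t - s)) ^ m"
      if st: "s \<in> {1..n}" "t \<in> {1..n}" for s t
    proof (cases "s < N \<or> t < N \<or> (s - t) + (t - s) < N")
      case True
      have "?I s t = 0" using True k by auto
      moreover have "\<bar>a s * a t * \<rho> ((s - t) + (t - s)) ^ m\<bar> \<le> \<bar>a s * a t\<bar> * 1"
        unfolding abs_mult[of "a s * a t"] power_abs
        using \<rho>1 by (intro mult_left_mono power_le_one) simp_all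
      ultimately show ?thesis using True by (auto simp: w_def)
    next
      case False
      then have w: "w s t = 0" by (simp add: w_def)
      have nn: "0 \<le> a s * a t * \<rho> ((s - t) + (t - s)) ^ m"
        using False nonneg by (intro mult_nonneg_nonneg zero_le_power) auto
      show ?thesis
      proof (cases "s \<in> {k<..2 * k} \<and> t \<in> {3 * k<..4 * k}")
        case True
        have a_ge: "c * real n powr (- \<delta>) \<le> a x" if "k < x" "x \<le> n" for x
        proof -
          have "c * real n powr (- \<delta>) \<le> real x powr (- \<delta>)"
            unfolding c_def using that k by (intro powr_comparable) auto
          also have "\<dots> \<le> a x" using that k by (intro N) auto
          finally show ?thesis .
        qed
        have d: "(s - t) + (t - s) \<le> n" "(s - t) + (t - s) \<ge> N" "(s - t) + (t - s) > 0" using st True k by auto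
        have "real n powr (- \<beta>) \<le> real ((s - t) + (t - s)) powr (- \<beta>)"
          using d \<beta> by (intro powr_mono2') (simp_all del: of_nat_add)
        also have "\<dots> \<le> \<rho> ((s - t) + (t - s))" using d by (intro N)
        finally have \<rho>_ge: "real n powr (- \<beta>) \<le> \<rho> ((s - t) + (t - s))" .
        have aa: "(c * real n powr (- \<delta>)) * (c * real n powr (- \<delta>)) \<le> a s * a t"
          using True k c False nonneg st by (intro mult_mono a_ge) auto
        have "(real n powr (- \<beta>)) ^ m \<le> \<rho> ((s - t) + (t - s)) ^ m"
          using \<rho>_ge by (intro power_mono) simp_all
        from mult_mono[OF aa this] have "g \<le> a s * a t * \<rho> ((s - t) + (t - s)) ^ m"
          unfolding g_def power2_eq_square using False nonneg by simp
        then show ?thesis using True w by simp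
      next
        case False
        show ?thesis unfolding if_not_P[OF False] w using nn by simp
      qed
    qed
    have "(\<Sum>s=1..n. \<Sum>t=1..n. ?I s t) = (\<Sum>s\<in>{k<..2 * k}. \<Sum>t\<in>{3 * k<..4 * k}. g)"
    proof -
      have sub: "{1..n} \<inter> {k<..2 * k} = {k<..2 * k}" "{1..n} \<inter> {3 * k<..4 * k} = {3 * k<..4 * k}"
        using k by auto
      have "(\<Sum>t=1..n. ?I s t) =
          (if s \<in> {k<..2 * k} then \<Sum>t=1..n. if t \<in> {3 * k<..4 * k} then g else 0 else 0)" for s
        by (cases "s \<in> {k<..2 * k}") (simp_all only: simp_thms if_True if_False sum.neutral_const)
      then show ?thesis by (simp only: sum.inter_restrict[symmetric] finite_atLeastAtMost sub)
    qed
    also have "\<dots> = (real k)\<^sup>2 * g" by (simp add: power2_eq_square)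
    \<comment> \<open>From n < 4k + 4 and \<open>k \<ge> 1\<close> it follows that n < 8k.\<close>
    also have "\<dots> \<ge> (real n / 8)\<^sup>2 * g"
      using k g by (intro mult_right_mono power_mono) auto
    moreover have "(real n / 8)\<^sup>2 * g = (c / 8)\<^sup>2 * real n powr \<theta>"
    proof -
      have n0: "real n > 0" using n by simp
      have "real n powr \<theta> = real n powr 2 * (real n powr (- \<delta>) * real n powr (- \<delta>)) * real n powr (- \<beta> * real m)"
        unfolding \<theta>(1) powr_add[symmetric] by (intro arg_cong[where f = "(powr) (real n)"]) simp
      also have "real n powr (- \<beta> * real m) = (real n powr (- \<beta>)) ^ m"
        using n0 by (simp add: powr_powr flip: powr_realpow)
      also have "real n powr 2 = (real n)\<^sup>2" using n0 by simp
      finally show ?thesis by (simp add: g_def power2_eq_square)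
    qed
    ultimately have I: "(c / 8)\<^sup>2 * real n powr \<theta> \<le> (\<Sum>s=1..n. \<Sum>t=1..n. ?I s t)" by linarith
    have "(\<Sum>s=1..n. \<Sum>t=1..n. w s t * \<bar>a s * a t\<bar>) \<le> (\<Sum>t=1..n. (a t)\<^sup>2 * (\<Sum>s=1..n. w s t))"
      by (rule schur_bound) (auto simp: w_def)
    also have "\<dots> \<le> (\<Sum>t=1..n. (a t)\<^sup>2 * ((if t < N then real n else 0) + E))"
    proof (intro sum_mono mult_left_mono)
      fix t
      show "(\<Sum>s=1..n. w s t) \<le> (if t < N then real n else 0) + E"
      proof (cases "t < N")
        case True
        have "(\<Sum>s=1..n. w s t) \<le> (\<Sum>s=1..n. 1)" by (intro sum_mono) (simp add: w_def)
        then show ?thesis using True by (simp add: E_def)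
      next
        case False
        have "(\<Sum>s=1..n. w s t) = real (card ({1..n} \<inter> {s. s < N \<or> t < N \<or> (s - t) + (t - s) < N}))"
          unfolding w_def by (subst sum.If_cases) simp_all
        also have "\<dots> \<le> real (card ({..<N} \<union> {t - N..t + N}))"
          using False by (intro of_nat_mono card_mono) auto
        also have "\<dots> \<le> E"
          using card_Un_le[of "{..<N}" "{t - N..t + N}"] by (simp add: E_def)
        finally show ?thesis using False by simp
      qed
    qed simp
    also have "\<dots> = real n * (\<Sum>t\<in>{1..n} \<inter> {t. t < N}. (a t)\<^sup>2) + E * (\<Sum>t=1..n. (a t)\<^sup>2)"
    proof -
      have "(a t)\<^sup>2 * ((if t < N then real n else 0) + E) =
          real n * (if t < N then (a t)\<^sup>2 else 0) + E * (a t)\<^sup>2" for t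
        by (simp add: algebra_simps)
      then show ?thesis by (simp add: sum.distrib sum.If_cases flip: sum_distrib_left)
    qed
    also have "\<dots> \<le> real n * D + E * (K * real n powr p)"
    proof (intro add_mono mult_left_mono)
      show "(\<Sum>t\<in>{1..n} \<inter> {t. t < N}. (a t)\<^sup>2) \<le> D"
        unfolding D_def by (intro sum_mono2) auto
      have "(\<Sum>t=1..n. (a t)\<^sup>2) \<le> (\<Sum>t\<le>n. (a t)\<^sup>2)" by (intro sum_mono2) auto
      also have "\<dots> \<le> K * real n powr p" using n by (intro sq) auto
      finally show "(\<Sum>t=1..n. (a t)\<^sup>2) \<le> K * real n powr p" .
    qed (simp_all add: E_def)
    finally have W: "(\<Sum>s=1..n. \<Sum>t=1..n. w s t * \<bar>a s * a t\<bar>) \<le> D * real n + E * K * real n powr p"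
      by (simp add: mult.commute mult.left_commute)
    have "(\<Sum>s=1..n. \<Sum>t=1..n. ?I s t) - (\<Sum>s=1..n. \<Sum>t=1..n. w s t * \<bar>a s * a t\<bar>) =
       (\<Sum>s=1..n. \<Sum>t=1..n. ?I s t - w s t * \<bar>a s * a t\<bar>)" by (simp only: sum_subtractf)
    also have "\<dots> \<le> (\<Sum>s=1..n. \<Sum>t=1..n. a s * a t * \<rho> ((s - t) + (t - s)) ^ m)"
      by (intro sum_mono pt)
    finally show ?thesis using I W by linarith
  qed
  \<comment> \<open>Rows with \<open>t < N\<close> cost order n and the band around the diagonal
    costs order n^p; both are negligible against n^\<theta> because 1 and p are below
    \<theta>.\<close>
  have lim: "(\<lambda>n. D * real n powr (1 - \<theta>) + E * K * real n powr (p - \<theta>)) \<longlonglongrightarrow> D * 0 + E * K * 0"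
    using \<theta> by (intro tendsto_intros tendsto_neg_powr filterlim_real_sequentially) auto
  have "\<forall>\<^sub>F n in sequentially. D * real n powr (1 - \<theta>) + E * K * real n powr (p - \<theta>) < (c / 8)\<^sup>2 / 2"
    using lim c by (intro order_tendstoD(2)) auto
  then have "\<forall>\<^sub>F n in sequentially. (c / 8)\<^sup>2 / 2 * real n powr \<theta> \<le>
    (\<Sum>s=1..n. \<Sum>t=1..n. a s * a t * \<rho> ((s - t) + (t - s)) ^ m)"
    using eventually_ge_at_top[of "4 * N + 4"]
  proof eventually_elim
    case (elim n)
    then have n: "real n > 0" by simp
    have "(D * real n powr (1 - \<theta>) + E * K * real n powr (p - \<theta>)) * real n powr \<theta> \<le> (c / 8)\<^sup>2 / 2 * real n powr \<theta>"
      using elim by (intro mult_right_mono) auto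
    moreover have "(D * real n powr (1 - \<theta>) + E * K * real n powr (p - \<theta>)) * real n powr \<theta> = D * real n + E * K * real n powr p"
      using n by (simp add: distrib_right mult.assoc flip: powr_add)
    ultimately show ?case using lower[OF elim(2)] by linarith
  qed
  then show ?thesis using c by (intro exI[of _ "(c / 8)\<^sup>2 / 2"]) auto
qed

subsection \<open>Almost sure negligibility by dyadic chaining\<close>

text \<open>\<open>P j\<close> is the sum up to n rounded down to a multiple of
  \<open>2 ^ j\<close>; passing to \<open>P (Suc j)\<close> removes nothing or one dyadic block,
  according to the j-th binary digit of n. Cauchy-Schwarz over the \<open>Suc K\<close> levels gives
  a bound that no longer depends on n, hence controls the maximum over all prefixes.\<close>

lemma dyadic_chaining:
  fixes x :: "nat \<Rightarrow> real"
  assumes n: "n \<le> 2 ^ K"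
  shows "(\<Sum>t<n. x t)\<^sup>2 \<le>
    real (Suc K) * (\<Sum>j\<le>K. \<Sum>i<2 ^ (K - j). (\<Sum>t=i * 2 ^ j..<i * 2 ^ j + 2 ^ j. x t)\<^sup>2)"
proof -
  define P where "P j = (\<Sum>t<2 ^ j * (n div 2 ^ j). x t)" for j
  let ?B = "\<lambda>j. \<Sum>i<2 ^ (K - j). (\<Sum>t=i * 2 ^ j..<i * 2 ^ j + 2 ^ j. x t)\<^sup>2"
  have "n < 2 ^ Suc K" using n by (simp add: order_le_less_trans)
  then have "P (Suc K) = 0" by (simp add: P_def)
  then have "(\<Sum>t<n. x t) = (\<Sum>j\<le>K. P j - P (Suc j))"
    by (simp only: sum_telescope) (simp add: P_def)
  then have "(\<Sum>t<n. x t)\<^sup>2 \<le> (\<Sum>j\<le>K. (P j - P (Suc j))\<^sup>2) * real (Suc K)"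
    using sum_squared_le_sum_of_squares[of "\<lambda>j. P j - P (Suc j)" "{..K}"] by simp
  moreover have "(P j - P (Suc j))\<^sup>2 \<le> ?B j" if "j \<le> K" for j
  proof (cases "even (n div 2 ^ j)")
    case True
    have "2 ^ Suc j * (n div 2 ^ Suc j) = 2 ^ j * (2 * (n div 2 ^ j div 2))"
      by (simp only: power_Suc2 div_mult2_eq mult.assoc)
    also have "2 * (n div 2 ^ j div 2) = n div 2 ^ j" using True by simp
    finally have "P (Suc j) = P j" by (simp only: P_def)
    then show ?thesis by (simp add: sum_nonneg)
  next
    case False
    then obtain i where i: "n div 2 ^ j = Suc i" "even i" by (cases "n div 2 ^ j") auto
    have "2 ^ Suc j * (n div 2 ^ Suc j) = 2 ^ j * (2 * (n div 2 ^ j div 2))"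
      by (simp only: power_Suc2 div_mult2_eq mult.assoc)
    also have "2 * (n div 2 ^ j div 2) = i" using i by (simp add: even_Suc_div_two)
    finally have "P (Suc j) = (\<Sum>t<2 ^ j * i. x t)" by (simp only: P_def)
    then have P': "P (Suc j) = (\<Sum>t<i * 2 ^ j. x t)" by (simp only: mult.commute)
    have "P j = (\<Sum>t<i * 2 ^ j + 2 ^ j. x t)" by (simp add: P_def i algebra_simps)
    also have "\<dots> = (\<Sum>t<i * 2 ^ j. x t) + (\<Sum>t=i * 2 ^ j..<i * 2 ^ j + 2 ^ j. x t)"
      unfolding lessThan_atLeast0 by (rule sum.atLeastLessThan_concat[symmetric]) simp_all
    finally have "P j - P (Suc j) = (\<Sum>t=i * 2 ^ j..<i * 2 ^ j + 2 ^ j. x t)" by (simp add: P')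
    moreover have "n div 2 ^ j \<le> 2 ^ K div 2 ^ j" using n by (rule div_le_mono)
    then have "i < 2 ^ (K - j)" using i that by (simp add: power_diff)
    then have "(\<Sum>t=i * 2 ^ j..<i * 2 ^ j + 2 ^ j. x t)\<^sup>2 \<le> ?B j"
      by (intro member_le_sum[of i _ "\<lambda>i. (\<Sum>t=i * 2 ^ j..<i * 2 ^ j + 2 ^ j. x t)\<^sup>2"]) auto
    ultimately show ?thesis by simp
  qed
  then have "(\<Sum>j\<le>K. (P j - P (Suc j))\<^sup>2) \<le> (\<Sum>j\<le>K. ?B j)" by (intro sum_mono) simp
  then have "(\<Sum>j\<le>K. (P j - P (Suc j))\<^sup>2) * real (Suc K) \<le> (\<Sum>j\<le>K. ?B j) * real (Suc K)"
    by (rule mult_right_mono) simp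
  ultimately show ?thesis unfolding mult.commute[of "real (Suc K)"] by (rule order_trans)
qed

text \<open>The term is the square of (k + 1) sqrt(r)^k, which is itself summable and eventually
  below 1, so the square is eventually the smaller of the two.\<close>

lemma summable_square_geometric:
  fixes r :: real
  assumes "0 < r" "r < 1"
  shows "summable (\<lambda>k. (real (Suc k))\<^sup>2 * r ^ k)"
proof -
  define f where "f k = real (Suc k) * sqrt r ^ k" for k
  have "summable f"
    unfolding f_def using geometric_deriv_sums[of "sqrt r"] assms by (auto simp: sums_iff)
  moreover from summable_LIMSEQ_zero[OF this] have "\<forall>\<^sub>F k in sequentially. f k < 1"
    by (rule order_tendstoD) simp
  then have "\<forall>\<^sub>F k in sequentially. norm ((real (Suc k))\<^sup>2 * r ^ k) \<le> f k"
  proof eventually_elim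
    case (elim k)
    have "(real (Suc k))\<^sup>2 * r ^ k = f k * f k"
    proof -
      have "r ^ k = sqrt r ^ k * sqrt r ^ k" using assms by (simp flip: power_mult_distrib)
      then show ?thesis by (simp only: f_def power2_eq_square mult.assoc mult.left_commute)
    qed
    also have "\<dots> \<le> f k * 1" using elim assms by (intro mult_left_mono) (auto simp: f_def)
    finally show ?case using assms by (simp add: abs_mult)
  qed
  ultimately show ?thesis by (rule summable_comparison_test_ev[rotated])
qed

text \<open>The series of the \<open>Z k\<close> has finite expectation, so it converges almost
  surely and its terms vanish.\<close>

lemma AE_tendsto_zero_of_summable_expectation:
  fixes Z :: "nat \<Rightarrow> 'a \<Rightarrow> real"
  assumes int: "\<And>k. integrable M (Z k)" and nonneg: "\<And>k \<omega>. 0 \<le> Z k \<omega>"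
    and summ: "summable (\<lambda>k. \<integral>\<omega>. Z k \<omega> \<partial>M)"
  shows "AE \<omega> in M. (\<lambda>k. Z k \<omega>) \<longlonglongrightarrow> 0"
proof -
  have [measurable]: "Z k \<in> borel_measurable M" for k using int by (rule borel_measurable_integrable)
  have "(\<integral>\<^sup>+\<omega>. (\<Sum>k. ennreal (Z k \<omega>)) \<partial>M) = (\<Sum>k. \<integral>\<^sup>+\<omega>. ennreal (Z k \<omega>) \<partial>M)"
    by (rule nn_integral_suminf) measurable
  also have "\<dots> = (\<Sum>k. ennreal (\<integral>\<omega>. Z k \<omega> \<partial>M))"
    by (intro suminf_cong nn_integral_eq_integral int AE_I2 nonneg)
  also have "\<dots> \<noteq> \<infinity>"
    unfolding infinity_ennreal_def
    by (intro ennreal_suminf_neq_top summ Bochner_Integration.integral_nonneg nonneg)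
  finally have "AE \<omega> in M. (\<Sum>k. ennreal (Z k \<omega>)) \<noteq> \<infinity>"
    by (rule nn_integral_PInf_AE[rotated]) measurable
  then show ?thesis
  proof eventually_elim
    case (elim \<omega>)
    then show ?case using summable_suminf_not_top[of "\<lambda>k. Z k \<omega>"] nonneg
      by (intro summable_LIMSEQ_zero) simp
  qed
qed

text \<open>The blocks of one level partition \<open>{..<2 ^ K}\<close>, so additivity in
  \<open>b\<close> and monotonicity of \<open>w\<close> give every level the same bound. The
  \<open>Suc K\<close> levels and the chaining factor cost only (K + 1)^2, which the geometric
  factor with ratio \<open>2 powr (\<theta>' - \<theta>) < 1\<close> outweighs.\<close>

lemma partial_sums_AE_negligible:
  fixes Y :: "nat \<Rightarrow> 'a \<Rightarrow> real" and b w :: "nat \<Rightarrow> real"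
  assumes int: "\<And>u l. integrable M (\<lambda>\<omega>. (\<Sum>t=u..<u + l. Y t \<omega>)\<^sup>2)"
    and block: "\<And>u l. (\<integral>\<omega>. (\<Sum>t=u..<u + l. Y t \<omega>)\<^sup>2 \<partial>M) \<le> (\<Sum>t=u..<u + l. b t) * w l"
    and b: "\<And>t. 0 \<le> b t" and w: "mono w"
    and total: "\<And>n. n \<ge> 1 \<Longrightarrow> (\<Sum>t<n. b t) * w n \<le> C * real n powr \<theta>'"
    and \<theta>: "\<theta>' < \<theta>" "0 \<le> \<theta>"
  shows "AE \<omega> in M. (\<lambda>n. (\<Sum>t<n. Y t \<omega>)\<^sup>2 / real n powr \<theta>) \<longlonglongrightarrow> 0"
proof -
  define D where "D K \<omega> = real (Suc K) * (\<Sum>j\<le>K. \<Sum>i<2 ^ (K - j). (\<Sum>t=i * 2 ^ j..<i * 2 ^ j + 2 ^ j. Y t \<omega>)\<^sup>2)"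
    for K :: nat and \<omega>
  define Z where "Z K \<omega> = D K \<omega> / (2 ^ K) powr \<theta>" for K \<omega>
  have Dint: "integrable M (D K)" for K unfolding D_def
    by (intro integrable_mult_right Bochner_Integration.integrable_sum int)
  have Dexp: "(\<integral>\<omega>. D K \<omega> \<partial>M) \<le> (real (Suc K))\<^sup>2 * (C * (2 ^ K) powr \<theta>')" for K
  proof -
    have "(\<integral>\<omega>. D K \<omega> \<partial>M) = real (Suc K) * (\<Sum>j\<le>K. \<Sum>i<2 ^ (K - j). \<integral>\<omega>. (\<Sum>t=i * 2 ^ j..<i * 2 ^ j + 2 ^ j. Y t \<omega>)\<^sup>2 \<partial>M)"
      unfolding D_def by (simp add: int)
    also have "\<dots> \<le> real (Suc K) * (\<Sum>j\<le>K. \<Sum>i<2 ^ (K - j). (\<Sum>t=i * 2 ^ j..<i * 2 ^ j + 2 ^ j. b t) * w (2 ^ j))"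
      by (intro mult_left_mono sum_mono block) simp
    also have "\<dots> = real (Suc K) * (\<Sum>j\<le>K. (\<Sum>t<2 ^ K. b t) * w (2 ^ j))"
    proof -
      have "(\<Sum>i<2 ^ (K - j). \<Sum>t=i * 2 ^ j..<i * 2 ^ j + 2 ^ j. b t) = (\<Sum>t<2 ^ K. b t)" if "j \<le> K" for j
        using that by (subst sum.nat_group) (simp flip: power_add)
      then show ?thesis by (simp flip: sum_distrib_right)
    qed
    also have "\<dots> \<le> real (Suc K) * (\<Sum>j\<le>K. (\<Sum>t<2 ^ K. b t) * w (2 ^ K))"
      by (intro mult_left_mono sum_mono monoD[OF w] power_increasing) (simp_all add: sum_nonneg b)
    also have "\<dots> = (real (Suc K))\<^sup>2 * ((\<Sum>t<2 ^ K. b t) * w (2 ^ K))" by (simp add: power2_eq_square)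
    also have "\<dots> \<le> (real (Suc K))\<^sup>2 * (C * (2 ^ K) powr \<theta>')"
      using total[of "2 ^ K"] by (intro mult_left_mono) simp_all
    finally show ?thesis .
  qed
  have "AE \<omega> in M. (\<lambda>K. Z K \<omega>) \<longlonglongrightarrow> 0"
  proof (rule AE_tendsto_zero_of_summable_expectation)
    show "integrable M (Z K)" for K unfolding Z_def using Dint by simp
    show nn: "0 \<le> Z K \<omega>" for K \<omega> unfolding Z_def D_def by (simp add: sum_nonneg)
    have r: "0 < (2::real) powr (\<theta>' - \<theta>)" "2 powr (\<theta>' - \<theta>) < (1::real)"
      using \<theta> by (simp_all add: powr_less_one)
    show "summable (\<lambda>K. \<integral>\<omega>. Z K \<omega> \<partial>M)"
    proof (rule summable_comparison_test')
      show "summable (\<lambda>K. C * ((real (Suc K))\<^sup>2 * (2 powr (\<theta>' - \<theta>)) ^ K))"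
        using summable_square_geometric[OF r] by (rule summable_mult)
      fix K :: nat
      have "(2 ^ K) powr \<theta>' / (2 ^ K) powr \<theta> = ((2 ^ K) powr (\<theta>' - \<theta>) :: real)"
        by (simp add: powr_diff)
      also have "\<dots> = (2 powr (\<theta>' - \<theta>)) ^ K"
        by (simp add: powr_powr mult.commute flip: powr_realpow)
      finally have q: "(2 ^ K) powr \<theta>' / (2 ^ K) powr \<theta> = ((2 powr (\<theta>' - \<theta>)) ^ K :: real)" .
      have "(\<integral>\<omega>. Z K \<omega> \<partial>M) = (\<integral>\<omega>. D K \<omega> \<partial>M) / (2 ^ K) powr \<theta>" by (simp add: Z_def)
      also have "\<dots> \<le> ((real (Suc K))\<^sup>2 * (C * (2 ^ K) powr \<theta>')) / (2 ^ K) powr \<theta>"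
        using Dexp by (intro divide_right_mono) simp_all
      also have "\<dots> = C * ((real (Suc K))\<^sup>2 * (2 powr (\<theta>' - \<theta>)) ^ K)"
        unfolding q[symmetric] by simp
      finally show "norm (\<integral>\<omega>. Z K \<omega> \<partial>M) \<le> C * ((real (Suc K))\<^sup>2 * (2 powr (\<theta>' - \<theta>)) ^ K)"
        using nn by (simp add: Bochner_Integration.integral_nonneg)
    qed
  qed
  then show ?thesis
  proof eventually_elim
    case (elim \<omega>)
    show ?case
    proof (rule LIMSEQ_I)
      fix e :: real assume e: "e > 0"
      \<comment> \<open>For n between \<open>2 ^ K\<close> and \<open>2 ^ Suc K\<close> the
        numerator is bounded at level \<open>Suc K\<close> and the denominator at level
        \<open>K\<close>; the mismatch is the factor \<open>2 powr \<theta>\<close>.\<close>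
      with LIMSEQ_D[OF elim, of "e / 2 powr \<theta>"]
      obtain K0 where K0: "\<And>K. K \<ge> K0 \<Longrightarrow> \<bar>Z K \<omega>\<bar> < e / 2 powr \<theta>" by auto
      have "norm ((\<Sum>t<n. Y t \<omega>)\<^sup>2 / real n powr \<theta> - 0) < e" if n: "n \<ge> 2 ^ K0" for n
      proof -
        have "n > 0" using n by (metis less_le_trans zero_less_numeral zero_less_power)
        then obtain K where K: "2 ^ K \<le> n" "n < 2 ^ Suc K" using ex_power_ivl1[of 2 n] by auto
        have "(2::nat) ^ K0 < 2 ^ Suc K" using n K by linarith
        then have "K0 \<le> Suc K" by (metis nat_power_less_imp_less less_imp_le zero_less_numeral)
        have "2 ^ K \<le> real n" using K(1) by (metis of_nat_le_iff of_nat_numeral of_nat_power)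
        have "(\<Sum>t<n. Y t \<omega>)\<^sup>2 / real n powr \<theta> \<le> D (Suc K) \<omega> / (2 ^ K) powr \<theta>"
        proof (rule frac_le)
          show "0 \<le> D (Suc K) \<omega>" unfolding D_def by (intro mult_nonneg_nonneg sum_nonneg) simp_all
          show "(\<Sum>t<n. Y t \<omega>)\<^sup>2 \<le> D (Suc K) \<omega>"
            unfolding D_def using K by (intro dyadic_chaining) simp
          show "(2 ^ K) powr \<theta> \<le> real n powr \<theta>"
            using \<open>2 ^ K \<le> real n\<close> \<theta> by (intro powr_mono2) simp_all
        qed simp
        also have "\<dots> = 2 powr \<theta> * Z (Suc K) \<omega>"
          by (simp add: Z_def powr_mult)
        also have "\<dots> < e" using K0[OF \<open>K0 \<le> Suc K\<close>] by (simp add: field_simps abs_less_iff)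
        finally show ?thesis by simp
      qed
      then show "\<exists>N. \<forall>n\<ge>N. norm ((\<Sum>t<n. Y t \<omega>)\<^sup>2 / real n powr \<theta> - 0) < e" by blast
    qed
  qed
qed

text \<open>All requirements on \<open>e\<close> hold strictly at \<open>e = 0\<close> and are continuous in \<open>e\<close>.\<close>

lemma exponent_choice:
  fixes \<alpha> d :: real and m :: nat
  assumes "0 < \<alpha>" "\<alpha> < 1" "\<alpha> * real m < 1" "2 * d + \<alpha> * real m < 1"
  obtains e where "e > 0" "1 < 2 - 2 * (d + e) - (\<alpha> + e) * real m"
    "max (1 - 2 * (d - e)) e + max (1 - (\<alpha> - e) * real (Suc m)) e < 2 - 2 * (d + e) - (\<alpha> + e) * real m"
proof -
  \<comment> \<open>The smaller of the two margins by which the last exponent has to exceed 1 and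
    the sum of the two maxima.\<close>
  define f where "f e = 2 - 2 * (d + e) - (\<alpha> + e) * real m -
     max 1 (max (1 - 2 * (d - e)) e + max (1 - (\<alpha> - e) * real (Suc m)) e)" for e
  have "isCont f 0" unfolding f_def by (intro continuous_intros)
  then have "(f \<longlongrightarrow> f 0) (at_right 0)" by (simp add: isCont_def filterlim_at_split)
  \<comment> \<open>Treating \<open>\<alpha> * real m\<close> as one variable \<open>x\<close> makes
    the claim at \<open>e = 0\<close> linear after case distinction on the maxima.\<close>
  moreover have "2 - 2 * d - x - max 1 (max (1 - 2 * d) 0 + max (1 - (\<alpha> + x)) 0) > 0"
    if "0 \<le> x" "x < 1" "2 * d + x < 1" for x
    using that assms(1,2) by (auto simp: max_def)
  from this[of "\<alpha> * real m"] have "f 0 > 0"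
    using assms by (simp add: f_def distrib_left)
  ultimately have "\<forall>\<^sub>F e in at_right 0. f e > 0" by (rule order_tendstoD)
  then have "\<forall>\<^sub>F e in at_right 0. f e > 0 \<and> 0 < e" using eventually_at_right_less[of 0] by (rule eventually_conj)
  then obtain e where "f e > 0" "0 < e" using eventually_happens[of _ "at_right (0::real)"] by fastforce
  then show ?thesis by (intro that[of e]) (simp_all add: f_def)
qed

theorem theorem3p1:
  fixes M :: "'a measure" and X :: "nat \<Rightarrow> 'a \<Rightarrow> real"
    and \<rho> :: "nat \<Rightarrow> real" and c \<alpha> d :: real and L0 la :: "real \<Rightarrow> real"
    and G :: "real \<Rightarrow> real" and m :: nat and a :: "nat \<Rightarrow> real"
    and S R :: "nat \<Rightarrow> 'a \<Rightarrow> real" and A :: "nat \<Rightarrow> real"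
  assumes "prob_space M"
    and "gaussian_sequence M X" and "stationary_sequence M X"
    and "\<And>t. t \<ge> 1 \<Longrightarrow> prob_space.expectation M (X t) = 0"
    and "\<And>t. t \<ge> 1 \<Longrightarrow> prob_space.expectation M (\<lambda>\<omega>. (X t \<omega>)\<^sup>2) = 1"
    and "\<And>t h. t \<ge> 1 \<Longrightarrow> prob_space.expectation M (\<lambda>\<omega>. X t \<omega> * X (t + h) \<omega>) = \<rho> h"
    and "\<rho> \<sim>[at_top] (\<lambda>h. c * real h powr (- \<alpha>) * L0 (real h))"
    and "c > 0" and "0 < \<alpha>" and "\<alpha> < 1" and "slowly_varying L0"
    and "has_hermite_rank G m"
    and "\<And>n. n \<ge> 1 \<Longrightarrow> a n = real n powr (- d) * la (real n)" and "slowly_varying la"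
    and "\<alpha> * real m < 1" and "2 * d + \<alpha> * real m < 1"
    and "\<And>n \<omega>. S n \<omega> = (\<Sum>t=1..n. a t * G (X t \<omega>))"
    and "\<And>n. A n = sqrt (prob_space.variance M (S n))"
    and "\<And>n \<omega>. R n \<omega> =
           S n \<omega> - hermite_coeff G m / fact m * (\<Sum>t=1..n. a t * hermite m (X t \<omega>))"
  shows "AE \<omega> in M.
    limsup (\<lambda>n. ereal (\<bar>R n \<omega>\<bar> / (A n * (2 * ln (ln (real n))) powr (real m / 2)))) = 0"
proof -
  note gauss = assms(2) and mean = assms(4) and var = assms(5) and cov = assms(6)
    and \<rho>_asymp = assms(7) and rank = assms(12) and a_def = assms(13)
    and S = assms(17) and A = assms(18) and R = assms(19)
  interpret prob_space M by fact
  define dist where "dist s t = (s - t) + (t - s)" for s t :: nat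
  define J where "J = hermite_coeff G m / fact m"
  define g where "g x = G x - J * hermite m x" for x
  define K where "K = (\<integral>x. (g x)\<^sup>2 \<partial>std_gaussian)"
  have m: "1 \<le> m" and "J \<noteq> 0" using rank by (auto simp: has_hermite_rank_def J_def)
  have K: "0 \<le> K" by (simp add: K_def)

  have pair: "gaussian_pair M (X s) (X t) (\<rho> (dist s t))" if "1 \<le> s" "1 \<le> t" for s t
  proof
    show "gaussian_rv M (\<lambda>\<omega>. u * X s \<omega> + v * X t \<omega>)" for u v
    \<comment> \<open>For equal indices \<open>{s, t}\<close> is a singleton, so the two
      coefficients must be added rather than assigned to separate indices.\<close>
    proof (cases "s = t")
      case True
      then show ?thesis
        using gauss[unfolded gaussian_sequence_def, rule_format, of "{s}" "\<lambda>_. u + v"] that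
        by (simp add: distrib_right)
    next
      case False
      then show ?thesis
        using gauss[unfolded gaussian_sequence_def, rule_format, of "{s, t}" "\<lambda>x. if x = s then u else v"] that
        by simp
    qed
    show "expectation (\<lambda>\<omega>. X s \<omega> * X t \<omega>) = \<rho> (dist s t)"
      using cov[of s "t - s"] cov[of t "s - t"] that
      by (cases "s \<le> t") (simp_all add: dist_def mult.commute)
  qed (use that mean var in simp_all)
  have series: "hermite_series g (Suc m) (\<lambda>q. hermite_coeff G q / fact q)"
    unfolding g_def[abs_def] J_def
    by (rule gaussian_pair.hermite_series_remainder[OF pair[of 1 1] rank]) simp_all
  note G_series = hermite_series_of_rank[OF rank]
  have \<rho>1: "\<bar>\<rho> h\<bar> \<le> 1" for h
    using gaussian_pair.cov_le_1[OF pair[of 1 "1 + h"]] by (simp add: dist_def)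
  have gX: "(\<lambda>\<omega>. g (X t \<omega>)) \<in> borel_measurable M" "integrable M (\<lambda>\<omega>. (g (X t \<omega>))\<^sup>2)" if "1 \<le> t" for t
    using gaussian_pair.hermite_series_X[OF pair[OF that that] series] by auto
  have GX: "(\<lambda>\<omega>. G (X t \<omega>)) \<in> borel_measurable M" "integrable M (\<lambda>\<omega>. (G (X t \<omega>))\<^sup>2)" if "1 \<le> t" for t
    using gaussian_pair.hermite_series_X[OF pair[OF that that] G_series] by auto
  have HX: "(\<lambda>\<omega>. hermite m (X t \<omega>)) \<in> borel_measurable M" "integrable M (\<lambda>\<omega>. (hermite m (X t \<omega>))\<^sup>2)"
    if "1 \<le> t" for t
    using gaussian_pair.square_integrable_hermite[OF pair[OF that that]]
      gaussian_pair.measurable_XY(1)[OF pair[OF that that]] by auto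
  have scaled: "integrable M (\<lambda>\<omega>. (a t * f (X t \<omega>))\<^sup>2)" if "integrable M (\<lambda>\<omega>. (f (X t \<omega>))\<^sup>2)"
    for t and f :: "real \<Rightarrow> real"
    using that by (simp add: power_mult_distrib)

  obtain e where e: "e > 0" "1 < 2 - 2 * (d + e) - (\<alpha> + e) * real m"
    "max (1 - 2 * (d - e)) e + max (1 - (\<alpha> - e) * real (Suc m)) e < 2 - 2 * (d + e) - (\<alpha> + e) * real m"
    using exponent_choice[of \<alpha> m d] assms(9,10,15,16) by blast
  \<comment> \<open>The growth exponents of the lower bound for A_n^2, of the sum of squared
    weights, and of the sum of the covariance powers. The maxima with \<open>e\<close> keep the last
    two positive when the corresponding series would converge.\<close>
  define \<theta> where "\<theta> = 2 - 2 * (d + e) - (\<alpha> + e) * real m"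
  define p where "p = max (1 - 2 * (d - e)) e"
  define q where "q = max (1 - (\<alpha> - e) * real (Suc m)) e"
  have exps: "p > 0" "q > 0" "1 < \<theta>" "p + q < \<theta>" "p < \<theta>"
    using e by (auto simp: p_def q_def \<theta>_def)

  have "\<forall>\<^sub>F t in sequentially. real t powr (- e) \<le> la (real t) \<and> la (real t) \<le> real t powr e"
    using slowly_varying_powr_bounds[OF assms(14) e(1)] filterlim_real_sequentially
    by (rule eventually_compose_filterlim)
  then have a_bounds: "\<forall>\<^sub>F t in sequentially. real t powr (- (d + e)) \<le> a t \<and> a t \<le> real t powr (- (d - e))"
    using eventually_ge_at_top[of 1]
  proof eventually_elim
    case (elim t)
    have "real t powr (- d) * real t powr (- e) \<le> real t powr (- d) * la (real t)"
      "real t powr (- d) * la (real t) \<le> real t powr (- d) * real t powr e"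
      using elim by (auto intro: mult_left_mono)
    then show ?case using a_def[of t] elim by (simp flip: powr_add)
  qed
  have \<rho>_bounds: "\<forall>\<^sub>F h in sequentially. real h powr (- (\<alpha> + e)) \<le> \<rho> h \<and> \<rho> h \<le> real h powr (- (\<alpha> - e))"
    using regularly_varying_powr_bounds[OF \<rho>_asymp assms(8,11) e(1)] .
  have "\<exists>C\<ge>0. \<forall>n\<ge>1. (\<Sum>t\<le>n. (a t)\<^sup>2) \<le> C * real n powr p"
  proof (rule sum_le_powr[OF exps(1)])
    show "\<forall>\<^sub>F t in sequentially. (a t)\<^sup>2 \<le> real t powr (p - 1)"
      using a_bounds eventually_ge_at_top[of 1]
    proof eventually_elim
      case (elim t)
      have "0 \<le> real t powr (- (d + e))" by simp
      also have "\<dots> \<le> a t" using elim by simp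
      finally have "(a t)\<^sup>2 \<le> (real t powr (- (d - e)))\<^sup>2" using elim by (intro power_mono) auto
      also have "\<dots> = real t powr (- (d - e) + - (d - e))"
        unfolding powr_add by (simp add: power2_eq_square)
      also have "\<dots> \<le> real t powr (p - 1)" using elim by (intro powr_mono) (auto simp: p_def)
      finally show ?case .
    qed
  qed simp
  then obtain C1 where C1: "C1 \<ge> 0" "\<And>n. n \<ge> 1 \<Longrightarrow> (\<Sum>t\<le>n. (a t)\<^sup>2) \<le> C1 * real n powr p" by blast
  have "- z \<le> max (1 - z) e - 1" for z :: real by simp
  from this[of "(\<alpha> - e) * real (Suc m)"] have q: "- (\<alpha> - e) * real (Suc m) \<le> q - 1"
    by (simp only: q_def minus_mult_left)
  have "\<exists>C\<ge>0. \<forall>n\<ge>1. (\<Sum>h\<le>n. \<bar>\<rho> h\<bar> ^ Suc m) \<le> C * real n powr q"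
  proof (rule sum_le_powr[OF exps(2)])
    show "\<forall>\<^sub>F h in sequentially. \<bar>\<rho> h\<bar> ^ Suc m \<le> real h powr (q - 1)"
      using \<rho>_bounds eventually_ge_at_top[of 1]
    proof eventually_elim
      case (elim h)
      have "0 \<le> real h powr (- (\<alpha> + e))" by simp
      also have "\<dots> \<le> \<rho> h" using elim by simp
      finally have "\<bar>\<rho> h\<bar> ^ Suc m \<le> (real h powr (- (\<alpha> - e))) ^ Suc m"
        using elim by (intro power_mono) auto
      also have "\<dots> = real h powr (- (\<alpha> - e) * real (Suc m))"
        using elim by (subst powr_powr[symmetric], subst powr_realpow) simp_all
      also have "\<dots> \<le> real h powr (q - 1)" using elim q by (intro powr_mono) simp_all
      finally show ?case .
    qed
  qed simp
  then obtain C2 where C2: "C2 \<ge> 0" "\<And>n. n \<ge> 1 \<Longrightarrow> (\<Sum>h\<le>n. \<bar>\<rho> h\<bar> ^ Suc m) \<le> C2 * real n powr q" by blast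

  \<comment> \<open>The index is shifted by one because the dyadic blocks start at 0 and the
    sequence at 1. The factor 2 in \<open>w\<close> counts both sides of the diagonal.\<close>
  define Y where "Y t \<omega> = a (Suc t) * g (X (Suc t) \<omega>)" for t \<omega>
  define b where "b t = K * (a (Suc t))\<^sup>2" for t
  define w where "w l = 2 * (\<Sum>h<l. \<bar>\<rho> h\<bar> ^ Suc m)" for l
  have Y: "Y t \<in> borel_measurable M" "integrable M (\<lambda>\<omega>. (Y t \<omega>)\<^sup>2)" for t
    unfolding Y_def using gX[of "Suc t"] by (auto intro: scaled)
  have "AE \<omega> in M. (\<lambda>n. (\<Sum>t<n. Y t \<omega>)\<^sup>2 / real n powr \<theta>) \<longlonglongrightarrow> 0"
  proof (rule partial_sums_AE_negligible)
    show "integrable M (\<lambda>\<omega>. (\<Sum>t=u..<u + l. Y t \<omega>)\<^sup>2)" for u l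
      using Y by (intro integrable_square_sum)
    show "expectation (\<lambda>\<omega>. (\<Sum>t=u..<u + l. Y t \<omega>)\<^sup>2) \<le> (\<Sum>t=u..<u + l. b t) * w l" for u l
    proof -
      let ?I = "{u..<u + l}" and ?w = "\<lambda>s t. K * \<bar>\<rho> (dist s t)\<bar> ^ Suc m"
      have "expectation (\<lambda>\<omega>. (\<Sum>t\<in>?I. Y t \<omega>)\<^sup>2) = (\<Sum>s\<in>?I. \<Sum>t\<in>?I. expectation (\<lambda>\<omega>. Y s \<omega> * Y t \<omega>))"
        unfolding power2_eq_square using Y by (intro integral_sum_mult_sum integrable_mult_of_squares)
      also have "\<dots> \<le> (\<Sum>s\<in>?I. \<Sum>t\<in>?I. ?w s t * \<bar>a (Suc s) * a (Suc t)\<bar>)"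
      proof (intro sum_mono)
        fix s t
        have "expectation (\<lambda>\<omega>. Y s \<omega> * Y t \<omega>) =
            a (Suc s) * a (Suc t) * expectation (\<lambda>\<omega>. g (X (Suc s) \<omega>) * g (X (Suc t) \<omega>))"
          unfolding Y_def by (simp add: mult.assoc mult.left_commute flip: integral_mult_right_zero)
        also have "\<dots> \<le> \<bar>a (Suc s) * a (Suc t)\<bar> * \<bar>expectation (\<lambda>\<omega>. g (X (Suc s) \<omega>) * g (X (Suc t) \<omega>))\<bar>"
          by (simp flip: abs_mult)
        also have "\<dots> \<le> \<bar>a (Suc s) * a (Suc t)\<bar> * (\<bar>\<rho> (dist (Suc s) (Suc t))\<bar> ^ Suc m * K)"
          unfolding K_def
          by (intro mult_left_mono gaussian_pair.hermite_rank_covariance_bound[OF pair series]) simp_all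
        finally show "expectation (\<lambda>\<omega>. Y s \<omega> * Y t \<omega>) \<le> ?w s t * \<bar>a (Suc s) * a (Suc t)\<bar>"
          by (simp add: dist_def mult.commute mult.left_commute)
      qed
      also have "\<dots> \<le> (\<Sum>t\<in>?I. (a (Suc t))\<^sup>2 * (\<Sum>s\<in>?I. ?w s t))"
        using K by (intro schur_bound[of ?w "\<lambda>t. a (Suc t)"]) (simp_all add: dist_def add.commute)
      also have "\<dots> \<le> (\<Sum>t\<in>?I. (a (Suc t))\<^sup>2 * (K * w l))"
      proof (intro sum_mono mult_left_mono)
        fix t assume "t \<in> ?I"
        from sum_distance_le[OF _ this, of "\<lambda>h. \<bar>\<rho> h\<bar> ^ Suc m"]
        have "(\<Sum>s\<in>?I. \<bar>\<rho> (dist s t)\<bar> ^ Suc m) \<le> w l" by (simp add: dist_def w_def)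
        then show "(\<Sum>s\<in>?I. ?w s t) \<le> K * w l"
          unfolding sum_distrib_left[symmetric] using K by (intro mult_left_mono)
      qed simp
      also have "\<dots> = (\<Sum>t\<in>?I. b t) * w l"
        unfolding b_def sum_distrib_right by (intro sum.cong refl) (simp only: ac_simps)
      finally show ?thesis .
    qed
    show "0 \<le> b t" for t using K by (simp add: b_def)
    show "mono w" unfolding w_def by (intro monoI mult_left_mono sum_mono2) auto
    show "(\<Sum>t<n. b t) * w n \<le> (K * C1 * (2 * C2)) * real n powr (p + q)" if n: "n \<ge> 1" for n
    proof -
      have "(\<Sum>t<n. (a (Suc t))\<^sup>2) = (\<Sum>t\<in>Suc ` {..<n}. (a t)\<^sup>2)" by (simp add: sum.reindex)
      also have "\<dots> \<le> (\<Sum>t\<le>n. (a t)\<^sup>2)" by (intro sum_mono2) auto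
      finally have "(\<Sum>t<n. (a (Suc t))\<^sup>2) \<le> C1 * real n powr p" using C1(2)[OF n] by linarith
      then have 1: "(\<Sum>t<n. b t) \<le> K * (C1 * real n powr p)"
        unfolding b_def sum_distrib_left[symmetric] using K by (intro mult_left_mono)
      have "(\<Sum>h<n. \<bar>\<rho> h\<bar> ^ Suc m) \<le> (\<Sum>h\<le>n. \<bar>\<rho> h\<bar> ^ Suc m)" by (intro sum_mono2) auto
      then have 2: "w n \<le> 2 * (C2 * real n powr q)" using C2(2)[OF n] by (simp add: w_def)
      have "(\<Sum>t<n. b t) * w n \<le> K * (C1 * real n powr p) * (2 * (C2 * real n powr q))"
        using 1 2 K C1(1) C2(1) by (intro mult_mono) (auto simp: w_def intro: sum_nonneg)
      then show ?thesis by (simp add: powr_add ac_simps)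
    qed
  qed (use exps in auto)
  moreover have R_Y: "R n \<omega> = (\<Sum>t<n. Y t \<omega>)" for n \<omega>
    unfolding R S Y_def g_def J_def
    by (simp add: sum.atLeast1_atMost_eq sum_distrib_left right_diff_distrib sum_subtractf ac_simps)
  ultimately have R_small: "AE \<omega> in M. (\<lambda>n. (R n \<omega>)\<^sup>2 / real n powr \<theta>) \<longlonglongrightarrow> 0" by simp

  define T where "T n \<omega> = (\<Sum>t=1..n. a t * hermite m (X t \<omega>))" for n \<omega>
  define Q where "Q n = (\<Sum>s=1..n. \<Sum>t=1..n. a s * a t * \<rho> (dist s t) ^ m)" for n
  \<comment> \<open>From S = R + J T with E(RT) = 0 the variance is E R^2 + J^2 E T^2, and the first
    summand is dropped.\<close>
  have A_lower: "J\<^sup>2 * fact m * Q n \<le> (A n)\<^sup>2" for n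
  proof -
    have R_sum: "R n = (\<lambda>\<omega>. \<Sum>t=1..n. a t * g (X t \<omega>))"
      unfolding R S g_def J_def
      by (simp add: fun_eq_iff sum_distrib_left right_diff_distrib sum_subtractf ac_simps)
    have S_RT: "S n = (\<lambda>\<omega>. R n \<omega> + J * T n \<omega>)" by (simp add: fun_eq_iff R T_def J_def)
    have Rm: "R n \<in> borel_measurable M" and R2: "integrable M (\<lambda>\<omega>. (R n \<omega>)\<^sup>2)"
      unfolding R_sum using gX by (auto intro!: integrable_square_sum scaled borel_measurable_sum borel_measurable_times)
    have Tm: "T n \<in> borel_measurable M" and T2: "integrable M (\<lambda>\<omega>. (T n \<omega>)\<^sup>2)"
      unfolding T_def using HX by (auto intro!: integrable_square_sum scaled borel_measurable_sum borel_measurable_times)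
    have RT: "integrable M (\<lambda>\<omega>. R n \<omega> * T n \<omega>)" using Rm Tm R2 T2 by (rule integrable_mult_of_squares)
    \<comment> \<open>Since \<open>hermite 0\<close> is the constant 1, centring is orthogonality at
      order 0; here \<open>1 \<le> m\<close> enters.\<close>
    have mean_S: "expectation (S n) = 0"
    proof -
      have G: "integrable M (\<lambda>\<omega>. G (X t \<omega>))" "expectation (\<lambda>\<omega>. G (X t \<omega>)) = 0" if "1 \<le> t" for t
      proof -
        show "integrable M (\<lambda>\<omega>. G (X t \<omega>))"
          using integrable_mult_of_squares[OF GX(1)[OF that] _ GX(2)[OF that], of "\<lambda>_. 1"] by simp
        show "expectation (\<lambda>\<omega>. G (X t \<omega>)) = 0"
          using gaussian_pair.hermite_rank_orthogonal[OF pair[OF that that] G_series, of 0] m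
          by (simp add: hermite_eq_poly)
      qed
      have "S n = (\<lambda>\<omega>. \<Sum>t=1..n. a t * G (X t \<omega>))" by (simp add: fun_eq_iff S)
      then show ?thesis using G by (simp add: Bochner_Integration.integral_sum)
    qed
    have RT0: "expectation (\<lambda>\<omega>. R n \<omega> * T n \<omega>) = 0"
    proof -
      have "expectation (\<lambda>\<omega>. (a s * g (X s \<omega>)) * (a t * hermite m (X t \<omega>))) = 0" if "1 \<le> s" "1 \<le> t" for s t
      proof -
        have "expectation (\<lambda>\<omega>. (a s * g (X s \<omega>)) * (a t * hermite m (X t \<omega>))) =
            (a s * a t) * expectation (\<lambda>\<omega>. g (X s \<omega>) * hermite m (X t \<omega>))"
          by (simp add: ac_simps flip: integral_mult_right_zero)
        also have "\<dots> = 0"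
          using gaussian_pair.hermite_rank_orthogonal[OF pair[OF that] series, of m] by simp
        finally show ?thesis .
      qed
      then show ?thesis unfolding R_sum T_def using gX HX
        by (subst integral_sum_mult_sum) (auto intro!: integrable_mult_of_squares scaled borel_measurable_times)
    qed
    have TT: "expectation (\<lambda>\<omega>. (T n \<omega>)\<^sup>2) = fact m * Q n"
    proof -
      have "expectation (\<lambda>\<omega>. (T n \<omega>)\<^sup>2) =
         (\<Sum>s=1..n. \<Sum>t=1..n. expectation (\<lambda>\<omega>. (a s * hermite m (X s \<omega>)) * (a t * hermite m (X t \<omega>))))"
        unfolding T_def power2_eq_square using HX
        by (intro integral_sum_mult_sum integrable_mult_of_squares) (auto intro!: scaled borel_measurable_times)
      also have "\<dots> = (\<Sum>s=1..n. \<Sum>t=1..n. fact m * (a s * a t * \<rho> (dist s t) ^ m))"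
      proof (intro sum.cong refl)
        fix s t assume st: "s \<in> {1..n}" "t \<in> {1..n}"
        have "expectation (\<lambda>\<omega>. (a s * hermite m (X s \<omega>)) * (a t * hermite m (X t \<omega>))) =
            (a s * a t) * expectation (\<lambda>\<omega>. hermite m (X s \<omega>) * hermite m (X t \<omega>))"
          by (simp add: ac_simps flip: integral_mult_right_zero)
        also have "\<dots> = fact m * (a s * a t * \<rho> (dist s t) ^ m)"
          using gaussian_pair.expectation_hermite_hermite[OF pair, of s t m] st by simp
        finally show "expectation (\<lambda>\<omega>. (a s * hermite m (X s \<omega>)) * (a t * hermite m (X t \<omega>))) =
          fact m * (a s * a t * \<rho> (dist s t) ^ m)" .
      qed
      finally show ?thesis by (simp add: Q_def sum_distrib_left)
    qed
    have "variance (S n) = expectation (\<lambda>\<omega>. (R n \<omega>)\<^sup>2 + (2 * J * (R n \<omega> * T n \<omega>) + J\<^sup>2 * (T n \<omega>)\<^sup>2))"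
      unfolding mean_S unfolding S_RT
      by (intro Bochner_Integration.integral_cong) (simp_all add: power2_sum power_mult_distrib ac_simps)
    also have "\<dots> = expectation (\<lambda>\<omega>. (R n \<omega>)\<^sup>2) + J\<^sup>2 * (fact m * Q n)"
      using R2 T2 RT by (simp add: RT0 TT)
    finally have "J\<^sup>2 * fact m * Q n \<le> variance (S n)" by (simp add: mult.assoc)
    then show ?thesis by (simp add: A)
  qed
  have "\<exists>\<kappa>>0. \<forall>\<^sub>F n in sequentially. \<kappa> * real n powr \<theta> \<le> Q n"
    unfolding Q_def dist_def
  proof (rule quadratic_form_lower_bound[of \<rho> "d + e" a "\<alpha> + e" C1 p])
    show "\<theta> = 2 - 2 * (d + e) - (\<alpha> + e) * real m" by (simp add: \<theta>_def)
  qed (use \<rho>1 a_bounds \<rho>_bounds C1(2) exps assms(9) e(1) in \<open>auto elim: eventually_mono\<close>)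
  then obtain \<kappa> where \<kappa>: "\<kappa> > 0" "\<forall>\<^sub>F n in sequentially. \<kappa> * real n powr \<theta> \<le> Q n" by blast
  define k where "k = J\<^sup>2 * fact m * \<kappa>"
  have k: "k > 0" using \<open>J \<noteq> 0\<close> \<kappa> by (simp add: k_def)
  have A_ge: "\<forall>\<^sub>F n in sequentially. k * real n powr \<theta> \<le> (A n)\<^sup>2"
    using \<kappa>(2)
  proof eventually_elim
    case (elim n)
    have "J\<^sup>2 * fact m * (\<kappa> * real n powr \<theta>) \<le> J\<^sup>2 * fact m * Q n" using elim by (intro mult_left_mono) auto
    then show ?case using A_lower[of n] by (simp add: k_def mult.assoc)
  qed
  have "filterlim (\<lambda>n. ln (ln (real n))) at_top sequentially"
    by (intro filterlim_compose[OF ln_at_top] filterlim_real_sequentially)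
  \<comment> \<open>Once the iterated logarithm is at least 1, its power in the denominator is too
    and can be bounded below by 1.\<close>
  then have LL: "\<forall>\<^sub>F n in sequentially. 1 \<le> ln (ln (real n))" by (simp add: filterlim_at_top)
  show ?thesis using R_small
  proof eventually_elim
    case (elim \<omega>)
    let ?q = "\<lambda>n. \<bar>R n \<omega>\<bar> / (A n * (2 * ln (ln (real n))) powr (real m / 2))"
    have "\<forall>\<^sub>F n in sequentially. norm (?q n) \<le> sqrt ((R n \<omega>)\<^sup>2 / real n powr \<theta> / k)"
      using A_ge LL eventually_ge_at_top[of 1]
    proof eventually_elim
      case (elim n)
      have pos: "0 < k * real n powr \<theta>" using k elim by simp
      have "0 \<le> A n" by (simp add: A)
      have "sqrt (k * real n powr \<theta>) \<le> A n" using elim(1) \<open>0 \<le> A n\<close> by (simp add: real_le_lsqrt)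
      moreover have "1 \<le> (2 * ln (ln (real n))) powr (real m / 2)"
        using elim(2) by (intro ge_one_powr_ge_zero) auto
      ultimately have "sqrt (k * real n powr \<theta>) * 1 \<le> A n * (2 * ln (ln (real n))) powr (real m / 2)"
        using \<open>0 \<le> A n\<close> by (intro mult_mono) auto
      then have "?q n \<le> \<bar>R n \<omega>\<bar> / sqrt (k * real n powr \<theta>)"
        using pos by (intro frac_le) simp_all
      also have "\<dots> = sqrt ((R n \<omega>)\<^sup>2 / real n powr \<theta> / k)"
        by (simp add: real_sqrt_divide real_sqrt_mult)
      finally show ?case using \<open>0 \<le> A n\<close> by simp
    qed
    moreover have "(\<lambda>n. sqrt ((R n \<omega>)\<^sup>2 / real n powr \<theta> / k)) \<longlonglongrightarrow> sqrt (0 / k)"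
      using elim k by (intro tendsto_real_sqrt tendsto_divide tendsto_const) auto
    ultimately have "?q \<longlonglongrightarrow> 0" by (intro Lim_null_comparison[of ?q]) simp_all
    then have "(\<lambda>n. ereal (?q n)) \<longlonglongrightarrow> 0" by (simp add: zero_ereal_def)
    then show ?case by (rule lim_imp_Limsup[OF trivial_limit_sequentially])
  qed
qed

end
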